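(* There is a $\Delta^1_1$ function $K:{}^3({}^\omega2)\to{}^\omega2$ such that for every $\Sigma^1_1$ set $A\subseteq{}^\omega2$ with $E_2\le_{\Delta^1_1}E_2\upharpoonright A$, the restriction $K\upharpoonright[A]^3_{E_2}$ is not continuous.
   Context: For $x,y\in{}^\omega2$, $\delta(x,y)=\sum\{\frac1{k+1}:x(k)\neq y(k)\}$; $E_2$ on ${}^\omega2$: $x\,E_2\,y$ iff $\delta(x,y)<\infty$. $[A]^3_{E_2}=\{(x_0,x_1,x_2)\in{}^3A:(\forall i\neq j)\neg(x_i\,E_2\,x_j)\}$ with the subspace topology. $E\le_{\Delta^1_1}F$ means there is a $\Delta^1_1$ function $\Phi$ with $a\,E\,b\iff\Phi(a)\,F\,\Phi(b)$. *)

theory Defs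
  imports "HOL-Analysis.Analysis"
begin

text \<open>The spaces used are \<open>nat \<Rightarrow> bool\<close> (Cantor space), \<open>nat \<Rightarrow> nat\<close> (Baire space) and finite
  products of these, all with the library's product topologies (\<open>bool\<close> and \<open>nat\<close> are discrete).
  The projective classes are the boldface ones.\<close>

type_synonym cantor = "nat \<Rightarrow> bool"

definition sigma11 :: "'a::topological_space set \<Rightarrow> bool" where
  "sigma11 A \<longleftrightarrow> (\<exists>C :: ('a \<times> (nat \<Rightarrow> nat)) set. closed C \<and> A = fst ` C)"

definition delta11 :: "'a::topological_space set \<Rightarrow> bool" where
  "delta11 A \<longleftrightarrow> sigma11 A \<and> sigma11 (- A)"

text \<open>A function is in the class if its graph, as a subset of the product space, is.\<close>

definition delta11_fun :: "('a::topological_space \<Rightarrow> 'b::topological_space) \<Rightarrow> bool" where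
  "delta11_fun f \<longleftrightarrow> delta11 {(x, y). y = f x}"

text \<open>Reducibility of a relation \<open>E\<close> on a whole space to the restriction of \<open>F\<close> to \<open>B\<close>; a map into
  \<open>B\<close> is a map into the ambient space with range contained in \<open>B\<close>.\<close>

definition delta11_reducible_to_restriction ::
  "('a::topological_space \<Rightarrow> 'a \<Rightarrow> bool) \<Rightarrow> ('b::topological_space \<Rightarrow> 'b \<Rightarrow> bool) \<Rightarrow> 'b set \<Rightarrow> bool" where
  "delta11_reducible_to_restriction E F B \<longleftrightarrow>
     (\<exists>\<Phi>. delta11_fun \<Phi> \<and> range \<Phi> \<subseteq> B \<and> (\<forall>a b. E a b \<longleftrightarrow> F (\<Phi> a) (\<Phi> b)))"

definition delta :: "cantor \<Rightarrow> cantor \<Rightarrow> ennreal" where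
  "delta x y = (\<Sum>k. if x k \<noteq> y k then ennreal (1 / (real k + 1)) else 0)"

definition E2 :: "cantor \<Rightarrow> cantor \<Rightarrow> bool" where
  "E2 x y \<longleftrightarrow> delta x y < \<infinity>"

definition inequiv_triples :: "('a \<Rightarrow> 'a \<Rightarrow> bool) \<Rightarrow> 'a set \<Rightarrow> ('a \<times> 'a \<times> 'a) set" where
  "inequiv_triples E A = {(x0, x1, x2). x0 \<in> A \<and> x1 \<in> A \<and> x2 \<in> A \<and>
     \<not> E x0 x1 \<and> \<not> E x1 x0 \<and> \<not> E x0 x2 \<and> \<not> E x2 x0 \<and> \<not> E x1 x2 \<and> \<not> E x2 x1}"

end

theory Submission
  imports Defs
begin

text \<open>Call a set of indices small if its reciprocals \<open>1 / (k + 1)\<close> have a finite sum, so that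
  \<open>x E2 y\<close> means that \<open>x\<close> and \<open>y\<close> differ on a small set. The function \<open>K (x, y, z)\<close> tells whether \<open>z\<close>
  lies between \<open>x\<close> and \<open>y\<close>, i.e. whether \<open>{k. x k = y k \<noteq> z k}\<close> is small.

  A reduction \<open>\<Phi>\<close> of \<open>E2\<close> to itself is continuous on a comeager set, since analytic sets have the
  Baire property. Starting from a sufficiently generic \<open>u\<close>, a fusion argument yields finite blocks of
  coordinates \<open>F 0, F 1, \<dots>\<close> such that flipping any family \<open>X\<close> of these blocks stays in the comeager set,
  and such that the effect on \<open>\<Phi> u\<close> of flipping \<open>F i\<close> is, up to a small error, independent of the other
  flips, confined to an interval of indices of its own, and of weight at least 1 there. Modulo small
  sets this gives a continuous copy of the power set of the naturals in the range of \<open>\<Phi>\<close> on which \<open>K\<close>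
  can be computed. In it the even numbers lie between the empty set and the full set, but the full set
  does not lie between the empty set and the even numbers. Exchanging the tails of the full set and
  the set of even numbers shows that \<open>K\<close> is discontinuous.\<close>

section \<open>Cylinder sets in sequence spaces\<close>

definition cyl :: "(nat \<Rightarrow> 'a) \<Rightarrow> nat \<Rightarrow> (nat \<Rightarrow> 'a) set" where
  "cyl v m = {w. \<forall>k<m. w k = v k}"

lemma mem_cyl_self [simp]: "v \<in> cyl v m"
  by (simp add: cyl_def)

lemma cyl_mono: "m \<le> n \<Longrightarrow> cyl v n \<subseteq> cyl v m"
  by (auto simp: cyl_def)

lemma cyl_eq: "w \<in> cyl v m \<Longrightarrow> cyl w m = cyl v m"
  by (auto simp: cyl_def)

lemma open_cyl: "open (cyl (v :: nat \<Rightarrow> 'a::discrete_topology) m)"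
proof -
  have "cyl v m = {w. \<forall>k\<in>{..<m}. w k \<in> {v k}}"
    by (auto simp: cyl_def)
  then show ?thesis
    by (simp only:) (rule product_topology_basis', auto simp: open_discrete)
qed

lemma open_contains_cyl:
  fixes U :: "(nat \<Rightarrow> 'a::topological_space) set"
  assumes "open U" "v \<in> U"
  obtains m where "cyl v m \<subseteq> U"
proof -
  obtain X where X: "v \<in> (\<Pi>\<^sub>E i\<in>UNIV. X i)" "finite {i. X i \<noteq> UNIV}" "(\<Pi>\<^sub>E i\<in>UNIV. X i) \<subseteq> U"
    using product_topology_open_contains_basis[of "\<lambda>i. euclidean" UNIV U v] assms
    by (auto simp: open_fun_def)
  obtain m where m: "\<forall>i\<in>{i. X i \<noteq> UNIV}. i < m"
    using X(2) finite_nat_set_iff_bounded by blast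
  have "w \<in> (\<Pi>\<^sub>E i\<in>UNIV. X i)" if w: "w \<in> cyl v m" for w
  proof (rule PiE_I)
    fix i
    show "w i \<in> X i"
    proof (cases "X i = UNIV")
      case False
      then have "w i = v i" using m w by (auto simp: cyl_def)
      then show ?thesis using X(1) by auto
    qed auto
  qed auto
  then have "cyl v m \<subseteq> U" using X(3) by (meson subset_iff)
  then show ?thesis by (rule that)
qed

lemma open_contains_cyl_prod:
  fixes U :: "('b::topological_space \<times> (nat \<Rightarrow> 'a::topological_space)) set"
  assumes "open U" "(x, v) \<in> U"
  obtains V m where "open V" "x \<in> V" "V \<times> cyl v m \<subseteq> U"
proof -
  obtain A B where AB: "open A" "open B" "x \<in> A" "v \<in> B" "A \<times> B \<subseteq> U"
    using open_prod_elim[OF assms] by (metis mem_Sigma_iff)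
  obtain m where "cyl v m \<subseteq> B"
    using open_contains_cyl[OF AB(2,4)] .
  then have "A \<times> cyl v m \<subseteq> U" using AB(5) by (meson Sigma_mono order_refl order_trans)
  then show ?thesis by (rule that[OF AB(1,3)])
qed

lemma countable_cyls: "countable (range (\<lambda>(v :: nat \<Rightarrow> 'a::countable, m). cyl v m))"
proof (rule countable_subset)
  show "range (\<lambda>(v :: nat \<Rightarrow> 'a, m). cyl v m) \<subseteq> range (\<lambda>s. {w. \<forall>k<length s. w k = s ! k})"
  proof clarify
    fix v :: "nat \<Rightarrow> 'a" and m
    show "cyl v m \<in> range (\<lambda>s. {w. \<forall>k<length s. w k = s ! k})"
      by (rule image_eqI[of _ _ "map v [0..<m]"]) (auto simp: cyl_def)
  qed
qed simp

section \<open>Meager sets\<close>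

definition meager :: "'a::topological_space set \<Rightarrow> bool" where
  "meager A \<longleftrightarrow> (\<exists>F :: nat \<Rightarrow> 'a set. (\<forall>n. closed (F n) \<and> interior (F n) = {}) \<and> A \<subseteq> (\<Union>n. F n))"

lemma meager_subset: "meager B \<Longrightarrow> A \<subseteq> B \<Longrightarrow> meager A"
  unfolding meager_def by blast

lemma meager_UN_nat:
  assumes "\<And>n :: nat. meager (A n)"
  shows "meager (\<Union>n. A n)"
proof -
  obtain F where F: "\<And>n k :: nat. closed (F n k) \<and> interior (F n k) = {}"
    "\<And>n. A n \<subseteq> (\<Union>k. F n k)"
    using assms unfolding meager_def by metis
  have "(\<Union>n. A n) \<subseteq> (\<Union>j. F (fst (prod_decode j)) (snd (prod_decode j)))"
  proof clarify
    fix x n assume "x \<in> A n"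
    then obtain k where "x \<in> F n k" using F(2) by blast
    then show "x \<in> (\<Union>j. F (fst (prod_decode j)) (snd (prod_decode j)))"
      by (intro UN_I[of "prod_encode (n, k)"]) auto
  qed
  then show ?thesis unfolding meager_def
    using F(1) by (intro exI[of _ "\<lambda>j. F (fst (prod_decode j)) (snd (prod_decode j))"]) auto
qed

lemma meager_nowhere_dense: "closed A \<Longrightarrow> interior A = {} \<Longrightarrow> meager A"
  unfolding meager_def by (intro exI[of _ "\<lambda>_. A"]) auto

lemma meager_empty [simp]: "meager {}"
  by (rule meager_nowhere_dense) auto

lemma meager_UN:
  assumes "countable I" "\<And>i. i \<in> I \<Longrightarrow> meager (A i)"
  shows "meager (\<Union>i\<in>I. A i)"
proof (cases "I = {}")
  case False
  then have I: "I = range (from_nat_into I)"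
    using assms(1) by (simp add: range_from_nat_into)
  have "meager (\<Union>n. A (from_nat_into I n))"
    by (rule meager_UN_nat) (rule assms(2)[OF from_nat_into[OF False]])
  then show ?thesis by (subst I) (simp only: image_image)
qed simp

lemma meager_Un: "meager A \<Longrightarrow> meager B \<Longrightarrow> meager (A \<union> B)"
  using meager_UN[of "{True, False}" "\<lambda>b. if b then A else B"] by (auto simp: Un_commute)

text \<open>The frontier of an open set misses the set, so its interior misses the closure as well;
  but the frontier is part of the closure.\<close>

lemma meager_frontier_open: "open A \<Longrightarrow> meager (frontier A)"
proof (rule meager_nowhere_dense)
  assume A: "open A"
  show "interior (frontier A) = {}"
  proof -
    have "interior (frontier A) \<inter> closure A = {}"
      using A open_Int_closure_eq_empty[of "interior (frontier A)" A] interior_subset[of "frontier A"]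
      by (auto simp: frontier_def interior_open)
    then show ?thesis
      using interior_subset[of "frontier A"] by (auto simp: frontier_def)
  qed
qed simp

lemma meager_frontier_closed: "closed A \<Longrightarrow> meager (frontier A)"
  using meager_frontier_open[of "- A"] by (simp add: frontier_complement open_Compl)

text \<open>The Baire category theorem for compact Hausdorff spaces.\<close>

lemma not_meager_UNIV: "\<not> meager (UNIV :: cantor set)"
proof
  assume "meager (UNIV :: cantor set)"
  then obtain F :: "nat \<Rightarrow> cantor set"
    where F: "\<And>n. closed (F n)" "\<And>n. interior (F n) = {}" "UNIV \<subseteq> (\<Union>n. F n)"
    unfolding meager_def by blast
  have "compact_space (product_topology (\<lambda>i :: nat. euclidean :: bool topology) UNIV)"
    unfolding compact_space_product_topology by (simp add: compact_space_def finite_imp_compact)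
  then have c: "compact_space (euclidean :: cantor topology)"
    by (simp add: euclidean_product_topology)
  have "Hausdorff_space (euclidean :: bool topology)"
    unfolding Hausdorff_space_def by (clarsimp simp: disjnt_def) (metis hausdorff)
  then have "Hausdorff_space (product_topology (\<lambda>i :: nat. euclidean :: bool topology) UNIV)"
    by (simp add: Hausdorff_space_product_topology)
  then have h: "Hausdorff_space (euclidean :: cantor topology)"
    by (simp add: euclidean_product_topology)
  have "euclidean interior_of \<Union>(range F) = {}"
    by (rule Baire_category_alt)
      (use c h F in \<open>auto intro: compact_imp_locally_compact_space compact_Hausdorff_imp_regular_space\<close>)
  then show False using F(3) by (auto simp: top.extremum_unique)
qed

section \<open>The Baire property of analytic sets\<close>

text \<open>The complement is the largest open set in which \<open>S\<close> is meager.\<close>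

definition category_hull :: "'a::topological_space set \<Rightarrow> 'a set" where
  "category_hull S = - \<Union>{V. open V \<and> meager (S \<inter> V)}"

lemma closed_category_hull: "closed (category_hull S)"
  unfolding category_hull_def closed_Compl by auto

lemma category_hull_subset_closure: "category_hull S \<subseteq> closure S"
proof -
  have "meager (S \<inter> - closure S)"
    using closure_subset[of S] by (metis disjoint_eq_subset_Compl double_compl meager_empty)
  then show ?thesis unfolding category_hull_def by blast
qed

text \<open>Each point of \<open>S\<close> outside the hull has a cylinder in which \<open>S\<close>
  is meager, and there are only countably many cylinders.\<close>

lemma meager_diff_category_hull:
  fixes S :: "(nat \<Rightarrow> 'a::{discrete_topology, countable}) set"
  shows "meager (S - category_hull S)"
proof -
  let ?B = "{V \<in> range (\<lambda>(v :: nat \<Rightarrow> 'a, m). cyl v m). meager (S \<inter> V)}"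
  have "meager (\<Union>V\<in>?B. S \<inter> V)"
    by (rule meager_UN) (use countable_cyls in \<open>auto intro: countable_subset\<close>)
  moreover have "S - category_hull S \<subseteq> (\<Union>V\<in>?B. S \<inter> V)"
  proof
    fix x assume x: "x \<in> S - category_hull S"
    then obtain V where V: "open V" "meager (S \<inter> V)" "x \<in> V"
      by (auto simp: category_hull_def)
    obtain m where "cyl x m \<subseteq> V" using open_contains_cyl[OF V(1,3)] .
    then have "meager (S \<inter> cyl x m)"
      using V(2) by (auto elim: meager_subset)
    then show "x \<in> (\<Union>V\<in>?B. S \<inter> V)"
      using x by (intro UN_I[of "cyl x m"]) auto
  qed
  ultimately show ?thesis by (rule meager_subset)
qed

text \<open>The argument for the Suslin operation. With \<open>B s\<close> the set of points having
  a witness that extends \<open>s\<close>, each \<open>B s\<close> lies up to a meager set in an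
  open set \<open>G s\<close>. For \<open>s = []\<close> this is one half of the claim; the other
  half follows branches through the \<open>G s\<close>.\<close>

lemma sigma11_Baire_property:
  fixes A :: "(nat \<Rightarrow> 'a::{discrete_topology, countable}) set"
  assumes "sigma11 A"
  obtains G where "open G" "meager ((A - G) \<union> (G - A))"
proof -
  obtain C :: "((nat \<Rightarrow> 'a) \<times> (nat \<Rightarrow> nat)) set" where C: "closed C" "A = fst ` C"
    using assms unfolding sigma11_def by blast
  define B where "B s = {x. \<exists>f. (x, f) \<in> C \<and> (\<forall>i<length s. f i = s ! i)}" for s
  define G where "G s = interior (category_hull (B s))" for s
  have A: "A = B []" using C(2) by (force simp: B_def)
  have B_split: "B s = (\<Union>n. B (s @ [n]))" for s
  proof (intro equalityI subsetI)
    fix x assume "x \<in> B s"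
    then obtain f where "(x, f) \<in> C" "\<forall>i<length s. f i = s ! i" by (auto simp: B_def)
    then have "x \<in> B (s @ [f (length s)])"
      unfolding B_def by (auto simp: nth_append less_Suc_eq intro!: exI[of _ f])
    then show "x \<in> (\<Union>n. B (s @ [n]))" by blast
  next
    fix x assume "x \<in> (\<Union>n. B (s @ [n]))"
    then obtain n f where f: "(x, f) \<in> C" "\<forall>i<length (s @ [n]). f i = (s @ [n]) ! i"
      by (auto simp: B_def)
    have "f i = s ! i" if "i < length s" for i
      using f(2)[rule_format, of i] that by (simp add: nth_append)
    then show "x \<in> B s" using f(1) by (auto simp: B_def)
  qed
  have BG: "meager (B s - G s)" for s
  proof (rule meager_subset)
    show "meager ((B s - category_hull (B s)) \<union> frontier (category_hull (B s)))"
      by (intro meager_Un meager_diff_category_hull meager_frontier_closed closed_category_hull)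
    show "B s - G s \<subseteq> (B s - category_hull (B s)) \<union> frontier (category_hull (B s))"
      using closed_category_hull[of "B s"] by (auto simp: G_def frontier_def)
  qed
  \<comment> \<open>Outside a meager set, every point of \<open>G []\<close> follows a branch along which it stays in \<open>G\<close>; as
    \<open>C\<close> is closed, the branch witnesses that the point belongs to \<open>A\<close>.\<close>
  have GW: "G s - (\<Union>n. G (s @ [n])) \<subseteq> frontier (\<Union>n. G (s @ [n]))" for s
  proof -
    define W where "W = (\<Union>n. G (s @ [n]))"
    \<comment> \<open>\<open>V\<close> is the part of \<open>G s\<close> outside the closure of
      \<open>W\<close>. There \<open>B s\<close> is covered by the meager sets
      \<open>B (s @ [n]) - G (s @ [n])\<close>, so \<open>V\<close> misses the hull that contains it
      and is empty.\<close>
    define V where "V = G s - closure W"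
    have "open V" by (auto simp: V_def G_def)
    have "meager (\<Union>n. B (s @ [n]) - G (s @ [n]))"
      by (rule meager_UN_nat) (rule BG)
    moreover have "B s \<inter> V \<subseteq> (\<Union>n. B (s @ [n]) - G (s @ [n]))"
      using B_split[of s] closure_subset[of W] by (auto simp: V_def W_def)
    ultimately have "meager (B s \<inter> V)" by (rule meager_subset)
    then have "V \<inter> category_hull (B s) = {}"
      using \<open>open V\<close> by (auto simp: category_hull_def)
    then have "V = {}"
      using interior_subset by (auto simp: V_def G_def)
    moreover have "open W" by (auto simp: W_def G_def)
    ultimately show ?thesis
      by (auto simp: V_def W_def[symmetric] frontier_def interior_open)
  qed
  define M where "M = (\<Union>s. frontier (\<Union>n. G (s @ [n])))"
  have "meager M" unfolding M_def
    by (intro meager_UN meager_frontier_open open_UN ballI) (auto simp: G_def)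
  have "G [] - A \<subseteq> M"
  proof (rule ccontr)
    assume "\<not> ?thesis"
    then obtain x where x: "x \<in> G []" "x \<notin> A" "x \<notin> M" by blast
    have step: "\<exists>n. x \<in> G (s @ [n])" if "x \<in> G s" for s
      using GW[of s] that x(3) by (auto simp: M_def)
    have "\<exists>t :: nat \<Rightarrow> nat list. \<forall>k. (x \<in> G (t k) \<and> length (t k) = k) \<and> (\<exists>n. t (Suc k) = t k @ [n])"
    proof (rule dependent_nat_choice)
      show "\<exists>s :: nat list. x \<in> G s \<and> length s = 0" using x(1) by auto
      fix s :: "nat list" and k assume s: "x \<in> G s \<and> length s = k"
      then obtain n where "x \<in> G (s @ [n])" using step by blast
      then show "\<exists>s'. (x \<in> G s' \<and> length s' = Suc k) \<and> (\<exists>n. s' = s @ [n])"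
        using s by auto
    qed
    then obtain t where t: "\<And>k. x \<in> G (t k)" "\<And>k. length (t k) = k"
      "\<And>k. \<exists>n. t (Suc k) = t k @ [n]" by blast
    define f where "f i = t (Suc i) ! i" for i
    have tf: "t k ! i = f i" if "i < k" for i k
      using that
    proof (induction k)
      case (Suc k)
      obtain n where n: "t (Suc k) = t k @ [n]" using t(3) by blast
      show ?case
      proof (cases "i = k")
        case False
        then show ?thesis using Suc n t(2) by (simp add: nth_append)
      qed (simp add: f_def)
    qed simp
    have "(x, f) \<in> C"
    proof (rule ccontr)
      assume "(x, f) \<notin> C"
      then obtain V m where V: "open V" "x \<in> V" "V \<times> cyl f m \<subseteq> - C"
        using open_contains_cyl_prod[of "- C" x f] C(1) by (auto simp: open_Compl)
      \<comment> \<open>\<open>G (t m)\<close> lies in the closure of \<open>B (t m)\<close>, which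
        thus has points arbitrarily close to \<open>x\<close>. Their witnesses begin like
        \<open>f\<close> and put a point of \<open>C\<close> into the neighbourhood chosen to avoid
        \<open>C\<close>.\<close>
      have "x \<in> closure (B (t m))"
        using t(1) interior_subset category_hull_subset_closure by (fastforce simp: G_def)
      then have "B (t m) \<inter> V \<noteq> {}"
        using V(1,2) by (metis closure_iff_nhds_not_empty order_refl)
      then obtain y g where yg: "y \<in> V" "(y, g) \<in> C" "\<forall>i<m. g i = t m ! i"
        using t(2) by (auto simp: B_def)
      then have "g \<in> cyl f m" using tf by (simp add: cyl_def)
      then have "(y, g) \<in> - C" using V(3) yg(1) by (meson SigmaI subsetD)
      then show False using yg(2) by simp
    qed
    then show False using x(2) C(2) by force
  qed
  then have "meager ((A - G []) \<union> (G [] - A))"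
    using \<open>meager M\<close> BG[of "[]"] by (auto intro!: meager_Un elim: meager_subset simp: A)
  then show ?thesis using that[of "G []"] by (simp add: G_def)
qed

section \<open>The summable ideal\<close>

definition weight :: "nat set \<Rightarrow> real" where
  "weight A = (\<Sum>k\<in>A. 1 / (real k + 1))"

text \<open>The bound ranges over the naturals so that it can be one coordinate of a witness in
  Baire space.\<close>

definition small :: "nat set \<Rightarrow> bool" where
  "small Z \<longleftrightarrow> (\<exists>M :: nat. \<forall>n. weight (Z \<inter> {..<n}) \<le> real M)"

lemma weight_mono: "finite B \<Longrightarrow> A \<subseteq> B \<Longrightarrow> weight A \<le> weight B"
  unfolding weight_def by (rule sum_mono2) auto

lemma weight_Un_le: "finite A \<Longrightarrow> finite B \<Longrightarrow> weight (A \<union> B) \<le> weight A + weight B"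
  unfolding weight_def by (subst sum_Un) (auto intro!: sum_nonneg)

lemma weight_eq_partial_sum:
  "weight (Z \<inter> {m..<n}) = (\<Sum>k=m..<n. if k \<in> Z then 1 / (real k + 1) else 0)"
  unfolding weight_def by (subst Int_commute) (rule sum.inter_restrict, simp)

lemma small_iff_summable:
  "small Z \<longleftrightarrow> summable (\<lambda>k. if k \<in> Z then 1 / (real k + 1) else 0)"
proof
  assume "small Z"
  then obtain M :: nat where "\<And>n. weight (Z \<inter> {0..<n}) \<le> real M"
    by (auto simp: small_def lessThan_atLeast0)
  then show "summable (\<lambda>k. if k \<in> Z then 1 / (real k + 1) else 0)"
    by (intro summableI_nonneg_bounded[where x = "real M"])
      (auto simp: weight_eq_partial_sum lessThan_atLeast0)
next
  let ?f = "\<lambda>k. if k \<in> Z then 1 / (real k + 1) else 0"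
  assume s: "summable ?f"
  obtain M :: nat where M: "suminf ?f \<le> real M" using real_arch_simple by blast
  have "weight (Z \<inter> {..<n}) \<le> real M" for n
    unfolding lessThan_atLeast0 weight_eq_partial_sum
    by (rule order_trans[OF sum_le_suminf[OF s] M]) auto
  then show "small Z" by (auto simp: small_def)
qed

lemma small_subset: "small B \<Longrightarrow> A \<subseteq> B \<Longrightarrow> small A"
  unfolding small_def by (meson Int_mono finite_Int finite_lessThan order.refl order.trans weight_mono)

lemma small_Un:
  assumes "small A" "small B"
  shows "small (A \<union> B)"
proof -
  obtain M N :: nat where M: "\<And>n. weight (A \<inter> {..<n}) \<le> real M" "\<And>n. weight (B \<inter> {..<n}) \<le> real N"
    using assms by (auto simp: small_def)
  have "weight ((A \<union> B) \<inter> {..<n}) \<le> real (M + N)" for n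
    using weight_Un_le[of "A \<inter> {..<n}" "B \<inter> {..<n}"] M[of n] by (simp add: Int_Un_distrib2)
  then show ?thesis unfolding small_def by blast
qed

lemma small_finite: "finite A \<Longrightarrow> small A"
  unfolding small_def
  by (meson inf_le1 order.trans real_arch_simple weight_mono)

lemma small_tail:
  assumes "small Z" "e > 0"
  obtains N where "\<And>n. weight (Z \<inter> {N..<n}) \<le> e"
proof -
  obtain N where "\<And>m n. m \<ge> N \<Longrightarrow>
      norm (\<Sum>k=m..<n. if k \<in> Z then 1 / (real k + 1) else (0 :: real)) < e"
    using assms unfolding small_iff_summable summable_Cauchy by meson
  then have "weight (Z \<inter> {N..<n}) \<le> e" for n
    unfolding weight_eq_partial_sum by (smt (verit) order_refl real_norm_def)
  then show ?thesis by (rule that)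
qed

lemma not_small_atLeast: "\<not> small {m..}"
proof
  assume "small {m..}"
  then have "small ({m..} \<union> {..<m})"
    by (rule small_Un[OF _ small_finite]) simp
  moreover have "{m..} \<union> {..<m} = UNIV" by auto
  ultimately have "small UNIV" by simp
  then have "summable (\<lambda>k. 1 / (real k + 1))"
    by (simp add: small_iff_summable)
  then have "summable (\<lambda>k. inverse (real (Suc k)))"
    by (simp add: field_simps)
  then show False
    using not_summable_harmonic[where 'a = real] summable_Suc_iff by blast
qed

lemma E2_iff_small: "E2 x y \<longleftrightarrow> small {k. x k \<noteq> y k}"
proof -
  let ?f = "\<lambda>k. if k \<in> {k. x k \<noteq> y k} then 1 / (real k + 1) else 0"
  have "delta x y = (\<Sum>k. ennreal (?f k))"
    unfolding delta_def by (rule suminf_cong) auto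
  moreover have "(\<Sum>k. ennreal (?f k)) < \<infinity> \<longleftrightarrow> summable ?f"
  proof
    assume "(\<Sum>k. ennreal (?f k)) < \<infinity>"
    then show "summable ?f" by (intro summable_suminf_not_top) auto
  next
    assume "summable ?f"
    then have "(\<Sum>k. ennreal (?f k)) \<noteq> top" by (intro ennreal_suminf_neq_top) auto
    then show "(\<Sum>k. ennreal (?f k)) < \<infinity>" by (simp add: less_top)
  qed
  ultimately show ?thesis by (simp add: E2_def small_iff_summable)
qed

section \<open>The betweenness function\<close>

definition off_segment :: "cantor \<times> cantor \<times> cantor \<Rightarrow> nat set" where
  "off_segment = (\<lambda>(x, y, z). {k. x k = y k \<and> z k \<noteq> x k})"

text \<open>The truth value is coded by a constant sequence, as values have to lie in Cantor
  space.\<close>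

definition betweenness :: "cantor \<times> cantor \<times> cantor \<Rightarrow> cantor" where
  "betweenness p = (\<lambda>_. small (off_segment p))"

lemma continuous_on_discrete_space:
  "continuous_on UNIV (f :: 'a::discrete_topology \<Rightarrow> 'b::topological_space)"
  by (simp add: continuous_on_open_vimage open_discrete)

lemma closed_Collect_discrete:
  assumes "continuous_on UNIV (h :: 'a::topological_space \<Rightarrow> 'b::discrete_topology)"
  shows "closed {q. P (h q)}"
proof -
  have "closed {b. P b}" by (simp add: closed_def open_discrete)
  then have "closed (h -` {b. P b})" using assms by (rule closed_vimage)
  then show ?thesis by (simp add: vimage_def)
qed

text \<open>Trades unboundedness for a single function \<open>f\<close>, which can serve as a
  witness in Baire space.\<close>

lemma not_small_iff:
  "\<not> small Z \<longleftrightarrow> (\<exists>f. \<forall>M. real M \<le> weight (Z \<inter> {..<f M}))"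
proof
  assume "\<not> small Z"
  then have "\<forall>M :: nat. \<exists>n. \<not> weight (Z \<inter> {..<n}) \<le> real M"
    unfolding small_def by blast
  then have "\<forall>M :: nat. \<exists>n. real M \<le> weight (Z \<inter> {..<n})"
    by (meson linear)
  then show "\<exists>f. \<forall>M. real M \<le> weight (Z \<inter> {..<f M})" by metis
next
  assume "\<exists>f. \<forall>M. real M \<le> weight (Z \<inter> {..<f M})"
  then obtain f where f: "\<And>M. real M \<le> weight (Z \<inter> {..<f M})" by blast
  show "\<not> small Z"
  proof
    assume "small Z"
    then obtain M :: nat where "\<And>n. weight (Z \<inter> {..<n}) \<le> real M" by (auto simp: small_def)
    from this[of "f (Suc M)"] f[of "Suc M"] show False by simp
  qed
qed

lemma continuous_on_weight_off_segment:
  "continuous_on UNIV (\<lambda>p. weight (off_segment p \<inter> {..<n}))"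
proof -
  define c :: "cantor \<Rightarrow> nat \<Rightarrow> real" where "c x k = of_bool (x k)" for x k
  have "continuous_on UNIV (of_bool :: bool \<Rightarrow> real)"
    by (rule continuous_on_discrete_space)
  then have coord: "continuous_on UNIV (\<lambda>x. c x k)" for k
    unfolding c_def by (rule continuous_on_compose2[where t = UNIV]) auto
  have c: "continuous_on UNIV (\<lambda>p. c (g p) k)"
    if "continuous_on UNIV g" for k and g :: "cantor \<times> cantor \<times> cantor \<Rightarrow> cantor"
    by (rule continuous_on_compose2[OF coord that]) auto
  \<comment> \<open>With truth values read as 0 and 1, the first factor is the indicator of
    \<open>x k = y k\<close> and the second that of \<open>z k \<noteq> x k\<close>.\<close>
  have "weight (off_segment p \<inter> {..<n}) =
      (\<Sum>k<n. (1 - \<bar>c (fst p) k - c (fst (snd p)) k\<bar>) * \<bar>c (snd (snd p)) k - c (fst p) k\<bar> / (real k + 1))" for p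
    unfolding lessThan_atLeast0 weight_eq_partial_sum
    by (rule sum.cong) (auto simp: off_segment_def c_def split: prod.split)
  then show ?thesis
    by (simp only:) (intro continuous_intros c, auto)
qed

type_synonym witnessed = "((cantor \<times> cantor \<times> cantor) \<times> cantor) \<times> (nat \<Rightarrow> nat)"

text \<open>Smallness is witnessed by a bound and its failure by a function, both subject to closed
  conditions. So the graph and its complement are projections of closed sets.\<close>

lemma delta11_fun_betweenness: "delta11_fun betweenness"
proof -
  define P :: "nat \<Rightarrow> witnessed \<Rightarrow> bool" where
    "P i q \<longleftrightarrow> (\<forall>n. weight (off_segment (fst (fst q)) \<inter> {..<n}) \<le> real (snd q i))" for i q
  \<comment> \<open>\<open>N\<close> reads its function from coordinate 1 on. Coordinate 0 stays
    free to name a wrong bit in the complement of the graph, where the bound of \<open>P\<close>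
    moves to coordinate 1.\<close>
  define N :: "witnessed \<Rightarrow> bool" where
    "N q \<longleftrightarrow> (\<forall>M. real M \<le> weight (off_segment (fst (fst q)) \<inter> {..<snd q (Suc M)}))" for q
  have proj: "continuous_on UNIV (\<lambda>q :: witnessed. snd q)"
    "continuous_on UNIV (\<lambda>q :: witnessed. snd (fst q))"
    "continuous_on UNIV (\<lambda>q :: witnessed. fst (fst q))"
    by (intro continuous_intros)+
  have coord: "continuous_on UNIV (\<lambda>q :: witnessed. snd q i)" for i
    by (rule continuous_on_compose2[OF continuous_on_product_coordinates proj(1)]) auto
  have value_coord: "continuous_on UNIV (\<lambda>q :: witnessed. snd (fst q) k)" for k
    by (rule continuous_on_compose2[OF continuous_on_product_coordinates proj(2)]) auto
  have W: "continuous_on UNIV (\<lambda>q :: witnessed. weight (off_segment (fst (fst q)) \<inter> {..<n}))" for n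
    by (rule continuous_on_compose2[OF continuous_on_weight_off_segment proj(3)]) auto
  have "continuous_on UNIV (real :: nat \<Rightarrow> real)" by (rule continuous_on_discrete_space)
  then have coord_real: "continuous_on UNIV (\<lambda>q :: witnessed. real (snd q i))" for i
    by (rule continuous_on_compose2[OF _ coord]) auto
  have P: "closed {q. P i q}" for i
    unfolding P_def by (intro closed_Collect_all closed_Collect_le W coord_real)
  have N: "closed {q. N q}"
  proof -
    \<comment> \<open>The length \<open>snd q (Suc M)\<close> varies with \<open>q\<close>. Fixing
      its value \<open>n\<close> leaves, for each \<open>M\<close> and \<open>n\<close>, the union
      of a clopen set and a closed set.\<close>
    have "{q. N q} = {q. \<forall>M n. snd q (Suc M) \<noteq> n \<or> real M \<le> weight (off_segment (fst (fst q)) \<inter> {..<n})}"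
      by (auto simp: N_def)
    moreover have "closed {q :: witnessed.
        \<forall>M n. snd q (Suc M) \<noteq> n \<or> real M \<le> weight (off_segment (fst (fst q)) \<inter> {..<n})}"
      by (intro closed_Collect_all closed_Collect_disj closed_Collect_le W continuous_on_const
          closed_Collect_discrete[OF coord])
    ultimately show ?thesis by simp
  qed
  have small_P: "small (off_segment p) \<longleftrightarrow> (\<exists>m. \<forall>f. f i = m \<longrightarrow> P i ((p, w), f))" for p w i
    by (auto simp: small_def P_def)
  have not_small_N: "\<not> small (off_segment p) \<longleftrightarrow> (\<exists>f. \<forall>m. N ((p, w), \<lambda>j. case j of 0 \<Rightarrow> m | Suc j \<Rightarrow> f j))" for p w
    by (auto simp: not_small_iff N_def)
  have P_small: "small (off_segment p)" if "P i ((p, w), f)" for p w f i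
    using that by (auto simp: small_def P_def)
  have N_not_small: "\<not> small (off_segment p)" if "N ((p, w), f)" for p w f
    using that by (auto simp: not_small_iff N_def intro: exI[of _ "\<lambda>M. f (Suc M)"])
  let ?graph = "{(p, w). w = betweenness p}"
  have "sigma11 ?graph"
    unfolding sigma11_def
  proof (intro exI conjI)
    let ?C = "{q. (\<forall>k. snd (fst q) k) \<and> P 0 q \<or> (\<forall>k. \<not> snd (fst q) k) \<and> N q}"
    show "closed ?C"
      by (intro closed_Collect_disj closed_Collect_conj closed_Collect_all P N
          closed_Collect_discrete[OF value_coord])
    show "?graph = fst ` ?C"
    proof (intro equalityI subsetI)
      fix pw assume "pw \<in> ?graph"
      then obtain p where pw: "pw = (p, betweenness p)" by auto
      show "pw \<in> fst ` ?C"
      proof (cases "small (off_segment p)")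
        case True
        then obtain m where "\<And>f. f 0 = m \<Longrightarrow> P 0 (pw, f)" using small_P pw by blast
        then have "(pw, \<lambda>_. m) \<in> ?C" using True pw by (auto simp: betweenness_def)
        then show ?thesis by force
      next
        case False
        then obtain f where "\<forall>m. N (pw, \<lambda>j. case j of 0 \<Rightarrow> m | Suc j \<Rightarrow> f j)"
          using not_small_N pw by blast
        then have "(pw, \<lambda>j. case j of 0 \<Rightarrow> 0 | Suc j \<Rightarrow> f j) \<in> ?C"
          using False pw by (auto simp: betweenness_def)
        then show ?thesis by force
      qed
    next
      fix pw assume "pw \<in> fst ` ?C"
      then show "pw \<in> ?graph"
        using P_small N_not_small by (fastforce simp: betweenness_def)
    qed
  qed
  moreover have "sigma11 (- ?graph)"
    unfolding sigma11_def
  proof (intro exI conjI)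
    \<comment> \<open>Coordinate 0 of the witness is an index at which the value is wrong. The
      quantifier over \<open>k\<close> resolves this variable index into clopen conditions.\<close>
    let ?C = "{q. (\<forall>k. snd q 0 \<noteq> k \<or> \<not> snd (fst q) k) \<and> P 1 q \<or>
      (\<forall>k. snd q 0 \<noteq> k \<or> snd (fst q) k) \<and> N q}"
    show "closed ?C"
      by (intro closed_Collect_disj closed_Collect_conj closed_Collect_all P N
          closed_Collect_discrete[OF value_coord] closed_Collect_discrete[OF coord])
    show "- ?graph = fst ` ?C"
    proof (intro equalityI subsetI)
      fix pw assume "pw \<in> - ?graph"
      then obtain p w where "pw = (p, w)" "w \<noteq> betweenness p"
        by blast
      then obtain k where pw: "pw = (p, w)" "w k \<noteq> small (off_segment p)"
        by (auto simp: betweenness_def fun_eq_iff)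
      show "pw \<in> fst ` ?C"
      proof (cases "small (off_segment p)")
        case True
        then obtain m where "\<And>f. f 1 = m \<Longrightarrow> P 1 (pw, f)" using small_P pw by blast
        then have "(pw, \<lambda>j. if j = 0 then k else m) \<in> ?C" using True pw by auto
        then show ?thesis by force
      next
        case False
        then obtain f where "\<forall>m. N (pw, \<lambda>j. case j of 0 \<Rightarrow> m | Suc j \<Rightarrow> f j)"
          using not_small_N pw by blast
        then have "(pw, \<lambda>j. case j of 0 \<Rightarrow> k | Suc j \<Rightarrow> f j) \<in> ?C"
          using False pw by auto
        then show ?thesis by force
      qed
    next
      fix pw assume "pw \<in> fst ` ?C"
      then show "pw \<in> - ?graph"
        using P_small N_not_small by (fastforce simp: betweenness_def)
    qed
  qed
  ultimately show ?thesis
    by (simp add: delta11_fun_def delta11_def)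
qed

section \<open>Generic continuity\<close>

definition flip :: "nat set \<Rightarrow> cantor \<Rightarrow> cantor" where
  "flip F u = (\<lambda>k. u k \<noteq> (k \<in> F))"

lemma flip_empty [simp]: "flip {} u = u"
  by (simp add: flip_def)

lemma flip_flip: "flip E (flip F u) = flip ((E - F) \<union> (F - E)) u"
  by (auto simp: flip_def)

lemma flip_involution [simp]: "flip F (flip F u) = u"
  by (simp add: flip_flip)

lemma flip_cyl: "w \<in> cyl u m \<Longrightarrow> flip F w \<in> cyl (flip F u) m"
  by (simp add: cyl_def flip_def)

lemma continuous_on_flip: "continuous_on UNIV (flip F)"
proof -
  have "continuous_on UNIV (\<lambda>b. b \<noteq> (k \<in> F))" for k
    by (rule continuous_on_discrete_space)
  then show ?thesis unfolding flip_def
    by (intro continuous_on_coordinatewise_then_product continuous_on_compose2[OF _ continuous_on_product_coordinates])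
      auto
qed

lemma interior_flip_vimage:
  assumes "interior S = {}"
  shows "interior (flip F -` S) = {}"
proof -
  let ?U = "interior (flip F -` S)"
  have "open (flip F -` ?U)"
    by (rule open_vimage) (auto simp: continuous_on_flip)
  moreover have "flip F -` ?U \<subseteq> S"
    using interior_subset[of "flip F -` S"] by force
  ultimately have "flip F -` ?U = {}"
    using assms interior_maximal by blast
  then show ?thesis by (metis empty_iff equals0I flip_involution vimage_eq)
qed

text \<open>A countable group under symmetric difference. The blocks are finite; cofinite sets are
  included because flipping a tail is what leaves the \<open>E2\<close> class.\<close>

definition fincofin :: "nat set set" where
  "fincofin = {F. finite F \<or> finite (- F)}"

lemma countable_fincofin: "countable fincofin"
proof -
  have "countable (Collect finite \<union> uminus ` Collect finite :: nat set set)"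
    by (intro countable_Un countable_image countable_Collect_finite)
  moreover have "fincofin = Collect finite \<union> uminus ` Collect finite"
    by (force simp: fincofin_def image_iff)
  ultimately show ?thesis by (simp only:)
qed

lemma fincofin_sym_diff: "E \<in> fincofin \<Longrightarrow> F \<in> fincofin \<Longrightarrow> (E - F) \<union> (F - E) \<in> fincofin"
proof -
  \<comment> \<open>The first identity serves the case of one finite and one cofinite set, the
    second that of two cofinite sets.\<close>
  have "- ((E - F) \<union> (F - E)) = (E \<inter> F) \<union> (- E \<inter> - F)"
    "(E - F) \<union> (F - E) = (- E - - F) \<union> (- F - - E)" by auto
  then show "E \<in> fincofin \<Longrightarrow> F \<in> fincofin \<Longrightarrow> ?thesis"
    unfolding fincofin_def mem_Collect_eq by (metis finite_Diff finite_Int finite_Un)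
qed

text \<open>Remove all preimages under \<open>flip F\<close>, for \<open>F\<close> in
  \<open>fincofin\<close>, of closed nowhere dense sets covering \<open>M\<close>. Only countably
  many sets are removed, and the remainder is invariant because these flips form a group.\<close>

lemma comeager_invariant_Gdelta:
  fixes M :: "cantor set"
  assumes "meager M"
  shows "\<exists>G :: nat \<Rightarrow> cantor set. (\<forall>n. open (G n)) \<and> meager (- (\<Inter>n. G n)) \<and> (\<Inter>n. G n) \<inter> M = {} \<and>
    (\<forall>F\<in>fincofin. \<forall>v\<in>(\<Inter>n. G n). flip F v \<in> (\<Inter>n. G n))"
proof -
  obtain S :: "nat \<Rightarrow> cantor set"
    where S: "\<And>n. closed (S n)" "\<And>n. interior (S n) = {}" "M \<subseteq> (\<Union>n. S n)"
    using assms unfolding meager_def by blast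
  define e where "e = from_nat_into fincofin"
  have ne: "{} \<in> fincofin" by (simp add: fincofin_def)
  then have e: "range e = fincofin"
    unfolding e_def using countable_fincofin by (intro range_from_nat_into) auto
  define G where "G j = - (flip (e (fst (prod_decode j))) -` S (snd (prod_decode j)))" for j
  have mem: "v \<in> (\<Inter>n. G n) \<longleftrightarrow> (\<forall>F\<in>fincofin. \<forall>n. flip F v \<notin> S n)" for v
  proof
    assume v: "v \<in> (\<Inter>n. G n)"
    show "\<forall>F\<in>fincofin. \<forall>n. flip F v \<notin> S n"
    proof (intro ballI allI)
      fix F n assume "F \<in> fincofin"
      then obtain i where "F = e i" using e by blast
      moreover have "v \<in> G (prod_encode (i, n))" using v by blast
      ultimately show "flip F v \<notin> S n" by (simp add: G_def)
    qed
  next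
    assume "\<forall>F\<in>fincofin. \<forall>n. flip F v \<notin> S n"
    then show "v \<in> (\<Inter>n. G n)" using e by (auto simp: G_def)
  qed
  have closed: "closed (flip F -` S n)" for F n
    by (rule closed_vimage) (auto simp: S continuous_on_flip)
  show ?thesis
  proof (intro exI[of _ G] conjI ballI allI)
    show "open (G n)" for n unfolding G_def using closed by (simp add: open_Compl)
    have "meager (flip F -` S n)" for F n
      by (intro meager_nowhere_dense closed interior_flip_vimage S)
    then have "meager (\<Union>j. flip (e (fst (prod_decode j))) -` S (snd (prod_decode j)))"
      by (rule meager_UN_nat)
    then show "meager (- (\<Inter>n. G n))" by (simp add: G_def)
    show "(\<Inter>n. G n) \<inter> M = {}"
    proof -
      have "v \<notin> M" if "v \<in> (\<Inter>n. G n)" for v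
        using that[unfolded mem, rule_format, OF ne] S(3) by auto
      then show ?thesis by blast
    qed
    show "flip F v \<in> (\<Inter>n. G n)" if "F \<in> fincofin" "v \<in> (\<Inter>n. G n)" for F v
      using that fincofin_sym_diff unfolding mem flip_flip by blast
  qed
qed

text \<open>The value of \<open>\<Phi>\<close>, over which one has to project, is coded by the even coordinates of the
  witness.\<close>

lemma sigma11_coordinate_preimage:
  fixes \<Phi> :: "'a::topological_space \<Rightarrow> cantor"
  assumes "sigma11 {(x, y). y = \<Phi> x}"
  shows "sigma11 {x. \<Phi> x j}"
proof -
  obtain C :: "(('a \<times> cantor) \<times> (nat \<Rightarrow> nat)) set"
    where C: "closed C" "{(x, y). y = \<Phi> x} = fst ` C"
    using assms unfolding sigma11_def by blast
  define h :: "'a \<times> (nat \<Rightarrow> nat) \<Rightarrow> ('a \<times> cantor) \<times> (nat \<Rightarrow> nat)" where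
    "h q = ((fst q, \<lambda>k. snd q (2 * k) = 1), \<lambda>k. snd q (2 * k + 1))" for q
  have coord: "continuous_on UNIV (\<lambda>q :: 'a \<times> (nat \<Rightarrow> nat). snd q i)" for i
    by (rule continuous_on_compose2[OF continuous_on_product_coordinates]) (auto intro: continuous_intros)
  have "continuous_on UNIV (\<lambda>n :: nat. n = 1)" by (rule continuous_on_discrete_space)
  then have "continuous_on UNIV (\<lambda>q :: 'a \<times> (nat \<Rightarrow> nat). snd q i = 1)" for i
    by (rule continuous_on_compose2[OF _ coord]) auto
  then have "continuous_on UNIV h"
    unfolding h_def by (intro continuous_intros coord)
  then have "closed (h -` C)" using C(1) by (simp add: closed_vimage)
  moreover have "closed {q :: 'a \<times> (nat \<Rightarrow> nat). snd q (2 * j) = 1}"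
    by (rule closed_Collect_discrete[OF coord])
  ultimately have "closed (h -` C \<inter> {q. snd q (2 * j) = 1})" by (rule closed_Int)
  moreover have "{x. \<Phi> x j} = fst ` (h -` C \<inter> {q. snd q (2 * j) = 1})"
  proof (intro equalityI subsetI)
    fix x assume "x \<in> {x. \<Phi> x j}"
    then have x: "\<Phi> x j" by simp
    have "(x, \<Phi> x) \<in> fst ` C" using C(2) by blast
    then obtain f where f: "((x, \<Phi> x), f) \<in> C" by force
    define g where "g k = (if even k then of_bool (\<Phi> x (k div 2)) else f (k div 2))" for k
    have "h (x, g) = ((x, \<Phi> x), f)" by (auto simp: h_def g_def)
    then have "(x, g) \<in> h -` C \<inter> {q. snd q (2 * j) = 1}"
      using f x by (simp add: g_def)
    then show "x \<in> fst ` (h -` C \<inter> {q. snd q (2 * j) = 1})" by force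
  next
    fix x assume "x \<in> fst ` (h -` C \<inter> {q. snd q (2 * j) = 1})"
    then obtain q where q: "x = fst q" "h q \<in> C" "snd q (2 * j) = 1" by blast
    have "(x, \<lambda>k. snd q (2 * k) = 1) \<in> {(x, y). y = \<Phi> x}"
      unfolding C(2) by (rule image_eqI[OF _ q(2)]) (simp add: h_def q(1))
    then have "\<Phi> x = (\<lambda>k. snd q (2 * k) = 1)" by simp
    then show "x \<in> {x. \<Phi> x j}" using q(3) by simp
  qed
  ultimately show ?thesis unfolding sigma11_def by blast
qed

text \<open>Each set \<open>{v. \<Phi> v j}\<close> has the Baire property and so agrees with an
  open set off a meager set. Once the frontiers of these open sets are discarded as well, every bit
  of \<open>\<Phi> v\<close> is locally constant off \<open>M\<close>.\<close>

lemma delta11_fun_continuous_comeager: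
  fixes \<Phi> :: "cantor \<Rightarrow> cantor"
  assumes "delta11_fun \<Phi>"
  shows "\<exists>M. meager M \<and> (\<forall>v n. v \<notin> M \<longrightarrow> (\<exists>m. \<forall>w\<in>cyl v m - M. \<Phi> w \<in> cyl (\<Phi> v) n))"
proof -
  have "\<exists>G. open G \<and> meager (({v. \<Phi> v j} - G) \<union> (G - {v. \<Phi> v j}))" for j
    using assms sigma11_coordinate_preimage[of \<Phi> j] sigma11_Baire_property[of "{v. \<Phi> v j}"]
    unfolding delta11_fun_def delta11_def by metis
  then obtain G where G: "\<And>j. open (G j)"
      "\<And>j. meager (({v. \<Phi> v j} - G j) \<union> (G j - {v. \<Phi> v j}))" by metis
  define M where "M = (\<Union>j. (({v. \<Phi> v j} - G j) \<union> (G j - {v. \<Phi> v j})) \<union> frontier (G j))"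
  have iff: "\<Phi> v j \<longleftrightarrow> v \<in> G j" if "v \<notin> M" for v j
    using that by (auto simp: M_def)
  show ?thesis
  proof (intro exI[of _ M] conjI allI impI)
    show "meager M" unfolding M_def
      by (intro meager_UN_nat meager_Un[OF G(2)] meager_frontier_open G(1))
    fix v n assume v: "v \<notin> M"
    have "\<exists>m. \<forall>w\<in>cyl v m - M. \<Phi> w j = \<Phi> v j" for j
    proof (cases "\<Phi> v j")
      case True
      then obtain m where "cyl v m \<subseteq> G j"
        using open_contains_cyl[OF G(1)] iff[OF v] by blast
      then show ?thesis using iff True by blast
    next
      case False
      then have "v \<notin> closure (G j)"
        using v iff[OF v] G(1) by (auto simp: M_def frontier_def interior_open)
      then obtain m where m: "cyl v m \<subseteq> - closure (G j)"
        using open_contains_cyl[of "- closure (G j)" v] by (auto simp: open_Compl)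
      have "\<not> \<Phi> w j" if "w \<in> cyl v m - M" for w
        using that m iff[of w j] closure_subset[of "G j"] by blast
      then show ?thesis using False by blast
    qed
    then obtain m where m: "\<And>j w. w \<in> cyl v (m j) - M \<Longrightarrow> \<Phi> w j = \<Phi> v j" by metis
    have "\<Phi> w \<in> cyl (\<Phi> v) n" if w: "w \<in> cyl v (\<Sum>j<n. m j) - M" for w
    proof -
      have "\<Phi> w j = \<Phi> v j" if "j < n" for j
      proof (rule m)
        have "m j \<le> (\<Sum>j<n. m j)" using that by (intro member_le_sum) auto
        then show "w \<in> cyl v (m j) - M" using w cyl_mono by blast
      qed
      then show ?thesis by (simp add: cyl_def)
    qed
    then show "\<exists>m. \<forall>w\<in>cyl v m - M. \<Phi> w \<in> cyl (\<Phi> v) n" by blast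
  qed
qed

section \<open>Fusion\<close>

definition diff :: "cantor \<Rightarrow> cantor \<Rightarrow> nat set" where
  "diff x y = {k. x k \<noteq> y k}"

lemma diff_Int_cong:
  assumes "x \<in> cyl x' n" "y \<in> cyl y' n"
  shows "diff x y \<inter> {m..<n} = diff x' y' \<inter> {m..<n}"
  using assms by (auto simp: diff_def cyl_def)

lemma E2_flip: "finite F \<Longrightarrow> E2 u (flip F u)"
  unfolding E2_iff_small by (rule small_finite, erule rev_finite_subset) (auto simp: flip_def)

lemma not_E2_flip_atLeast: "\<not> E2 u (flip {m..} u)"
proof -
  have "{k. u k \<noteq> flip {m..} u k} = {m..}" by (auto simp: flip_def)
  then show ?thesis by (simp add: E2_iff_small not_small_atLeast)
qed

text \<open>The discrepancies allowed by \<open>close\<close> add up to at most 2 and so form a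
  small set, while infinitely many of the differences in \<open>far\<close> do not. Hence, modulo
  small sets, \<open>\<psi> X\<close> is read off block by block. \<open>local\<close> is the
  continuity of \<open>\<psi>\<close>.\<close>

locale power_set_copy =
  fixes \<psi> :: "(nat \<Rightarrow> bool) \<Rightarrow> cantor" and a :: cantor and b :: "nat \<Rightarrow> cantor" and N :: "nat \<Rightarrow> nat"
  assumes N: "strict_mono N"
    and local: "(\<And>j. j < i \<Longrightarrow> X j = Y j) \<Longrightarrow> \<psi> X \<in> cyl (\<psi> Y) (N i)"
    and far: "1 \<le> weight (diff a (b i) \<inter> {N i..<N (Suc i)})"
    and close: "weight (diff (if X i then b i else a) (\<psi> X) \<inter> {N i..<N (Suc i)}) \<le> 1 / 2 ^ i"

text \<open>\<open>C\<close> is given as an intersection of open sets so that a fusion can force its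
  limit points into \<open>C\<close> by entering one \<open>G n\<close> at each stage.
  \<open>cont\<close> is the continuity of the restriction of \<open>\<Phi>\<close> to
  \<open>C\<close>.\<close>

locale generic_reduction =
  fixes \<Phi> :: "cantor \<Rightarrow> cantor" and G :: "nat \<Rightarrow> cantor set" and C
  assumes reduction: "E2 a b \<longleftrightarrow> E2 (\<Phi> a) (\<Phi> b)"
    and C_def: "C = (\<Inter>n. G n)"
    and open_G: "open (G n)"
    and comeager_C: "meager (- C)"
    and flip_C: "F \<in> fincofin \<Longrightarrow> v \<in> C \<Longrightarrow> flip F v \<in> C"
    and cont: "v \<in> C \<Longrightarrow> \<exists>m. \<forall>w\<in>C \<inter> cyl v m. \<Phi> w \<in> cyl (\<Phi> v) n"
begin

lemma flip_C_finite: "finite F \<Longrightarrow> v \<in> C \<Longrightarrow> flip F v \<in> C"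
  by (rule flip_C) (simp_all add: fincofin_def)

definition tail_close :: "nat set \<Rightarrow> nat \<Rightarrow> nat \<Rightarrow> cantor set" where
  "tail_close E i N = {w \<in> C. \<forall>n. weight (diff (\<Phi> w) (\<Phi> (flip E w)) \<inter> {N..<n}) \<le> 1 / 2 ^ i}"

text \<open>Each bound involves finitely many values of \<open>\<Phi>\<close> at \<open>w\<close>
  and at \<open>flip E w\<close>, and by \<open>cont\<close> these are shared by nearby points of
  \<open>C\<close>.\<close>

lemma tail_close_closed:
  assumes "finite E" "w \<in> C" "w \<in> closure (tail_close E i N)"
  shows "w \<in> tail_close E i N"
proof -
  have "weight (diff (\<Phi> w) (\<Phi> (flip E w)) \<inter> {N..<n}) \<le> 1 / 2 ^ i" for n
  proof -
    obtain m where m: "\<And>w'. w' \<in> C \<inter> cyl w m \<Longrightarrow> \<Phi> w' \<in> cyl (\<Phi> w) n"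
      using cont[OF assms(2)] by blast
    obtain m' where m': "\<And>w'. w' \<in> C \<inter> cyl (flip E w) m' \<Longrightarrow> \<Phi> w' \<in> cyl (\<Phi> (flip E w)) n"
      using cont[OF flip_C_finite[OF assms(1,2)]] by blast
    have "tail_close E i N \<inter> cyl w (max m m') \<noteq> {}"
      using assms(3) open_cyl by (metis closure_iff_nhds_not_empty mem_cyl_self order_refl)
    then obtain w' where w': "w' \<in> tail_close E i N" "w' \<in> cyl w (max m m')" by blast
    then have "w' \<in> C" by (simp add: tail_close_def)
    have near: "w' \<in> cyl w m" "w' \<in> cyl w m'"
      using w'(2) cyl_mono[of m "max m m'" w] cyl_mono[of m' "max m m'" w] by auto
    have "\<Phi> w' \<in> cyl (\<Phi> w) n" "\<Phi> (flip E w') \<in> cyl (\<Phi> (flip E w)) n"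
      using m[of w'] m'[of "flip E w'"] near(1) flip_cyl[OF near(2)] \<open>w' \<in> C\<close>
        flip_C_finite[OF assms(1)] by blast+
    from diff_Int_cong[OF this, of N] show ?thesis
      using w'(1) unfolding tail_close_def by (metis (no_types, lifting) mem_Collect_eq)
  qed
  then show ?thesis using assms(2) by (simp add: tail_close_def)
qed

text \<open>For finite \<open>E\<close> the sets \<open>tail_close E i N\<close> cover
  \<open>C\<close> as \<open>N\<close> varies. Near a generic point a single \<open>N\<close>
  controls the effect of flipping \<open>E\<close> at all points of \<open>C\<close>.\<close>

definition generic :: "cantor \<Rightarrow> bool" where
  "generic u \<longleftrightarrow> u \<in> C \<and> (\<forall>E i. finite E \<longrightarrow> (\<exists>N m. C \<inter> cyl u m \<subseteq> tail_close E i N))"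

text \<open>Choose \<open>u\<close> in \<open>C\<close> off the frontiers of the closures of all
  \<open>tail_close E i N\<close>, which are meager. As flipping a finite set preserves the
  \<open>E2\<close> class, \<open>u\<close> lies in some \<open>tail_close E i N\<close>, hence in
  the interior of its closure, and the set is closed relative to \<open>C\<close>.\<close>

lemma ex_generic: "\<exists>u. generic u"
proof -
  let ?M = "- C \<union> (\<Union>E\<in>Collect finite. \<Union>i. \<Union>N. frontier (closure (tail_close E i N)))"
  have "meager ?M"
    by (intro meager_Un meager_UN meager_frontier_closed comeager_C)
      (auto simp: countable_Collect_finite)
  then obtain u where u: "u \<notin> ?M"
    using not_meager_UNIV by (metis UNIV_eq_I)
  have "u \<in> C" using u by blast
  moreover have "\<exists>N m. C \<inter> cyl u m \<subseteq> tail_close E i N" if E: "finite E" for E i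
  proof -
    have "small (diff (\<Phi> u) (\<Phi> (flip E u)))"
      using E2_flip[OF E] reduction by (simp add: E2_iff_small diff_def)
    then obtain N where "u \<in> tail_close E i N"
      using small_tail[of _ "1 / 2 ^ i"] \<open>u \<in> C\<close> by (auto simp: tail_close_def)
    then have "u \<in> interior (closure (tail_close E i N))"
      using u E closure_subset[of "tail_close E i N"] by (auto simp: frontier_def)
    then obtain m where "cyl u m \<subseteq> closure (tail_close E i N)"
      using open_contains_cyl[OF open_interior] interior_subset by (metis order_trans)
    then have "C \<inter> cyl u m \<subseteq> tail_close E i N"
      using tail_close_closed[OF E] by blast
    then show ?thesis by blast
  qed
  ultimately show ?thesis unfolding generic_def by blast
qed

lemma tail_close_mono: "N \<le> N' \<Longrightarrow> tail_close E i N \<subseteq> tail_close E i N'"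
  unfolding tail_close_def
  by (auto elim!: order_trans[rotated] intro!: weight_mono)

text \<open>Flipping the whole tail \<open>{m..}\<close> leaves the \<open>E2\<close> class, so the
  images differ with weight 1 below some \<open>n\<close>. By continuity at the flipped point, a
  long enough finite part of the tail yields the same values there.\<close>

lemma far_flip:
  assumes "u \<in> C"
  obtains F n where "finite F" "F \<subseteq> {m..}" "1 \<le> weight (diff (\<Phi> u) (\<Phi> (flip F u)) \<inter> {..<n})"
proof -
  let ?v = "flip {m..} u"
  have "- {m..} = {..<m}" by auto
  then have v: "?v \<in> C"
    using assms by (intro flip_C) (auto simp: fincofin_def)
  have "\<not> small (diff (\<Phi> u) (\<Phi> ?v))"
    using not_E2_flip_atLeast reduction by (simp add: E2_iff_small diff_def)
  then obtain n where n: "1 \<le> weight (diff (\<Phi> u) (\<Phi> ?v) \<inter> {..<n})"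
    unfolding not_small_iff by (metis of_nat_1)
  obtain m' where m': "\<And>w. w \<in> C \<inter> cyl ?v m' \<Longrightarrow> \<Phi> w \<in> cyl (\<Phi> ?v) n"
    using cont[OF v] by blast
  let ?w = "flip {m..<m'} u"
  have "?w \<in> C" using assms by (intro flip_C_finite) auto
  moreover have "?w \<in> cyl ?v m'" by (auto simp: cyl_def flip_def)
  ultimately have "?w \<in> C \<inter> cyl ?v m'" by blast
  then have "diff (\<Phi> u) (\<Phi> ?w) \<inter> {0..<n} = diff (\<Phi> u) (\<Phi> ?v) \<inter> {0..<n}"
    using m' by (intro diff_Int_cong) auto
  then show ?thesis using n by (intro that[of "{m..<m'}" n]) (auto simp: lessThan_atLeast0)
qed

text \<open>\<open>H\<close> collects the unions of the blocks chosen so far. The first conjunct keeps the limit points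
  in \<open>C\<close>, the second makes later flips act independently of those in \<open>H\<close>, and the third protects the
  values below \<open>N\<close> from later flips.\<close>

definition stage :: "cantor \<Rightarrow> nat \<Rightarrow> nat set set \<Rightarrow> nat \<Rightarrow> nat \<Rightarrow> bool" where
  "stage u i H m N \<longleftrightarrow> (\<forall>E\<in>H. cyl (flip E u) m \<subseteq> G i \<and> C \<inter> cyl u m \<subseteq> tail_close E i N \<and>
     (\<forall>w\<in>C \<inter> cyl (flip E u) m. \<Phi> w \<in> cyl (\<Phi> (flip E u)) N))"

lemma stage_exists:
  assumes "generic u"
    and H: "finite H" "\<And>E. E \<in> H \<Longrightarrow> finite E"
  obtains m N where "m0 \<le> m" "N0 \<le> N" "stage u i H m N"
proof -
  have u: "u \<in> C" "\<forall>E\<in>H. \<exists>N m. C \<inter> cyl u m \<subseteq> tail_close E i N"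
    using assms(1) H(2) by (auto simp: generic_def)
  then obtain N1 m1 where 1: "\<And>E. E \<in> H \<Longrightarrow> C \<inter> cyl u (m1 E) \<subseteq> tail_close E i (N1 E)"
    by metis
  \<comment> \<open>Sums over the finite set \<open>H\<close> serve as common upper bounds.
    \<open>N\<close> is fixed before \<open>m3\<close>, since the modulus of continuity depends on
    it.\<close>
  define N where "N = N0 + sum N1 H"
  have "\<exists>m. cyl (flip E u) m \<subseteq> G i" if "E \<in> H" for E
    using flip_C_finite[OF H(2)[OF that] u(1)] open_contains_cyl[OF open_G] by (metis C_def INT_iff UNIV_I)
  then obtain m2 where 2: "\<And>E. E \<in> H \<Longrightarrow> cyl (flip E u) (m2 E) \<subseteq> G i" by metis
  have "\<forall>E\<in>H. \<exists>m. \<forall>w\<in>C \<inter> cyl (flip E u) m. \<Phi> w \<in> cyl (\<Phi> (flip E u)) N"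
    using cont[OF flip_C_finite[OF H(2) u(1)]] by blast
  then obtain m3 where 3: "\<And>E. E \<in> H \<Longrightarrow> \<forall>w\<in>C \<inter> cyl (flip E u) (m3 E). \<Phi> w \<in> cyl (\<Phi> (flip E u)) N"
    by metis
  define m where "m = m0 + sum m1 H + sum m2 H + sum m3 H"
  have "stage u i H m N"
    unfolding stage_def
  proof
    fix E assume E: "E \<in> H"
    have le: "f E \<le> sum f H" for f :: "nat set \<Rightarrow> nat"
      using E H(1) by (intro member_le_sum) auto
    have "m1 E \<le> m" "m2 E \<le> m" "m3 E \<le> m" "N1 E \<le> N"
      using le[of m1] le[of m2] le[of m3] le[of N1] by (auto simp: m_def N_def)
    then show "cyl (flip E u) m \<subseteq> G i \<and> C \<inter> cyl u m \<subseteq> tail_close E i N \<and>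
       (\<forall>w\<in>C \<inter> cyl (flip E u) m. \<Phi> w \<in> cyl (\<Phi> (flip E u)) N)"
      using 1[OF E] 2[OF E] 3[OF E] cyl_mono[of "m1 E" m u] cyl_mono[of "m2 E" m "flip E u"]
        cyl_mono[of "m3 E" m "flip E u"] tail_close_mono[of "N1 E" N E i] by blast
  qed
  then show ?thesis using that[of m N] by (simp add: m_def N_def)
qed

text \<open>Dependent choice on triples of \<open>H\<close>, \<open>m\<close> and \<open>N\<close>.
  Given a stage, \<open>far_flip\<close> supplies the next block beyond \<open>m\<close>, and
  \<open>stage_exists\<close> for the enlarged \<open>H\<close> supplies new bounds beyond
  it.\<close>

lemma fusion_sequence:
  "\<exists>u F H m N. u \<in> C \<and> {} \<in> H 0 \<and> (\<forall>i :: nat. stage u i (H i) (m i) (N i) \<and> H (Suc i) = H i \<union> (\<lambda>E. E \<union> F i) ` H i \<and>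
      finite (F i) \<and> F i \<subseteq> {m i..<m (Suc i)} \<and> m i \<le> m (Suc i) \<and> N i < N (Suc i) \<and>
      1 \<le> weight (diff (\<Phi> u) (\<Phi> (flip (F i) u)) \<inter> {N i..<N (Suc i)}))"
proof -
  obtain u where u: "generic u" using ex_generic ..
  then have "u \<in> C" by (simp add: generic_def)
  let ?P = "\<lambda>i (H, m, N). stage u i H m N \<and> finite H \<and> (\<forall>E\<in>H. finite E) \<and> {} \<in> H"
  let ?Q = "\<lambda>i (H, m, N) (H', m', N'). \<exists>F. H' = H \<union> (\<lambda>E. E \<union> F) ` H \<and> finite F \<and> F \<subseteq> {m..<m'} \<and>
    m \<le> m' \<and> N < N' \<and> 1 \<le> weight (diff (\<Phi> u) (\<Phi> (flip F u)) \<inter> {N..<N'})"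
  have "\<exists>f. \<forall>i. ?P i (f i) \<and> ?Q i (f i) (f (Suc i))"
  proof (rule dependent_nat_choice)
    obtain m N where "stage u 0 {{}} m N"
      using stage_exists[of u "{{}}" 0 0 0] u by auto
    then show "\<exists>s. ?P 0 s" by (intro exI[of _ "({{}}, m, N)"]) auto
    fix s :: "nat set set \<times> nat \<times> nat" and i :: nat assume s: "?P i s"
    obtain H m N where s_eq: "s = (H, m, N)" by (cases s)
    have st: "stage u i H m N" "finite H" "\<forall>E\<in>H. finite E" "{} \<in> H"
      using s by (auto simp: s_eq)
    obtain F n where F: "finite F" "F \<subseteq> {m..}" "1 \<le> weight (diff (\<Phi> u) (\<Phi> (flip F u)) \<inter> {..<n})"
      using far_flip[OF \<open>u \<in> C\<close>] .
    let ?H = "H \<union> (\<lambda>E. E \<union> F) ` H"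
    \<comment> \<open>\<open>m'\<close> exceeds every element of \<open>F\<close>, and
      \<open>N'\<close> exceeds both \<open>N\<close> and \<open>n\<close>;
      \<open>insert 0 F\<close> gives \<open>Max\<close> a value for empty \<open>F\<close>
      too.\<close>
    obtain m' N' where mN': "m + Suc (Max (insert 0 F)) \<le> m'" "Suc (N + n) \<le> N'" "stage u (Suc i) ?H m' N'"
      using stage_exists[of u ?H "m + Suc (Max (insert 0 F))" "Suc (N + n)" "Suc i"] u st F(1) by auto
    have "F \<subseteq> {m..<m'}"
    proof
      fix k assume k: "k \<in> F"
      then have "k \<le> Max (insert 0 F)" using F(1) by simp
      then show "k \<in> {m..<m'}" using mN'(1) F(2) k by auto
    qed
    moreover have "1 \<le> weight (diff (\<Phi> u) (\<Phi> (flip F u)) \<inter> {N..<N'})"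
    proof -
      \<comment> \<open>\<open>F\<close> lies above \<open>m\<close> and \<open>{}\<close> is in
        \<open>H\<close>, so the stage protects the values below \<open>N\<close>. The weight found
        below \<open>n\<close> thus lies entirely between \<open>N\<close> and
        \<open>N'\<close>.\<close>
      have "flip F u \<in> C" using F(1) \<open>u \<in> C\<close> by (rule flip_C_finite)
      moreover have "flip F u \<in> cyl u m" using F(2) by (auto simp: cyl_def flip_def)
      ultimately have "\<Phi> (flip F u) \<in> cyl (\<Phi> u) N"
        using st(1,4) unfolding stage_def by (metis Int_iff flip_empty)
      then have "diff (\<Phi> u) (\<Phi> (flip F u)) \<inter> {..<n} \<subseteq> diff (\<Phi> u) (\<Phi> (flip F u)) \<inter> {N..<N'}"
        using mN'(2) by (force simp: diff_def cyl_def not_le[symmetric])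
      then show ?thesis using F(3) weight_mono
        by (meson finite_Int finite_atLeastLessThan order_trans)
    qed
    ultimately show "\<exists>s'. ?P (Suc i) s' \<and> ?Q i s s'"
      using mN' st F(1) unfolding s_eq
      by (intro exI[of _ "(?H, m', N')"]) (auto intro!: exI[of _ F])
  qed
  then obtain f where all: "\<forall>i. ?P i (f i) \<and> ?Q i (f i) (f (Suc i))" ..
  have f: "?P i (f i)" "?Q i (f i) (f (Suc i))" for i
    using spec[OF all, of i] by (rule conjunct1, rule conjunct2)
  define H m N where "H i = fst (f i)" and "m i = fst (snd (f i))" and "N i = snd (snd (f i))" for i
  have f_eq: "f i = (H i, m i, N i)" for i by (simp add: H_def m_def N_def)
  have "\<exists>F. \<forall>i. H (Suc i) = H i \<union> (\<lambda>E. E \<union> F i) ` H i \<and> finite (F i) \<and> F i \<subseteq> {m i..<m (Suc i)} \<and>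
    m i \<le> m (Suc i) \<and> N i < N (Suc i) \<and>
    1 \<le> weight (diff (\<Phi> u) (\<Phi> (flip (F i) u)) \<inter> {N i..<N (Suc i)})"
    using f(2) unfolding f_eq by (intro choice) simp
  then obtain F where F: "\<And>i. H (Suc i) = H i \<union> (\<lambda>E. E \<union> F i) ` H i \<and> finite (F i) \<and>
    F i \<subseteq> {m i..<m (Suc i)} \<and> m i \<le> m (Suc i) \<and> N i < N (Suc i) \<and>
    1 \<le> weight (diff (\<Phi> u) (\<Phi> (flip (F i) u)) \<inter> {N i..<N (Suc i)})" by blast
  have "u \<in> C \<and> {} \<in> H 0 \<and> (\<forall>i. stage u i (H i) (m i) (N i) \<and> H (Suc i) = H i \<union> (\<lambda>E. E \<union> F i) ` H i \<and>
      finite (F i) \<and> F i \<subseteq> {m i..<m (Suc i)} \<and> m i \<le> m (Suc i) \<and> N i < N (Suc i) \<and>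
      1 \<le> weight (diff (\<Phi> u) (\<Phi> (flip (F i) u)) \<inter> {N i..<N (Suc i)}))"
    using \<open>u \<in> C\<close> F f(1) by (simp add: f_eq)
  then show ?thesis by (intro exI)
qed

lemma fusion: "\<exists>\<psi> a b N. power_set_copy \<psi> a b N \<and> range \<psi> \<subseteq> range \<Phi>"
proof -
  obtain u F H m N where u: "u \<in> C" and H0: "{} \<in> H 0" and seq: "\<forall>i :: nat. stage u i (H i) (m i) (N i) \<and> H (Suc i) = H i \<union> (\<lambda>E. E \<union> F i) ` H i \<and>
      finite (F i) \<and> F i \<subseteq> {m i..<m (Suc i)} \<and> m i \<le> m (Suc i) \<and> N i < N (Suc i) \<and>
      1 \<le> weight (diff (\<Phi> u) (\<Phi> (flip (F i) u)) \<inter> {N i..<N (Suc i)})"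
    using fusion_sequence by (elim exE conjE) (rule that)
  have stage: "\<And>i. stage u i (H i) (m i) (N i)"
    and H: "\<And>i. H (Suc i) = H i \<union> (\<lambda>E. E \<union> F i) ` H i"
    and F: "\<And>i. finite (F i)" "\<And>i. F i \<subseteq> {m i..<m (Suc i)}"
    and m: "\<And>i. m i \<le> m (Suc i)" and N: "\<And>i. N i < N (Suc i)"
    and far: "\<And>i. 1 \<le> weight (diff (\<Phi> u) (\<Phi> (flip (F i) u)) \<inter> {N i..<N (Suc i)})"
    using seq by blast+
  have m_mono: "i \<le> j \<Longrightarrow> m i \<le> m j" for i j
    using m by (rule lift_Suc_mono_le)
  define E where "E X i = (\<Union>j\<in>{j. j < i \<and> X j}. F j)" for X i
  define U where "U X = flip (\<Union>j\<in>{j. X j}. F j) u" for X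
  have E_Suc: "E X (Suc i) = (if X i then E X i \<union> F i else E X i)" for X i
    by (auto simp: E_def less_Suc_eq)
  have E_H: "E X i \<in> H i" for X i
  proof (induction i)
    case 0
    then show ?case using H0 by (simp add: E_def)
  next
    case (Suc i)
    then show ?case by (auto simp: E_Suc H)
  qed
  have E_less: "k < m i" if k: "k \<in> E X i" for k X i
  proof -
    obtain j where "j < i" "k \<in> F j" using k by (auto simp: E_def)
    then show ?thesis using F(2)[of j] m_mono[of "Suc j" i] by auto
  qed
  have U_cyl: "U X \<in> cyl (flip (E X i) u) (m i)" for X i
  proof -
    have "j < i" if "k \<in> F j" "k < m i" for j k
      using that F(2)[of j] m_mono[of i j] by (force simp: not_le[symmetric])
    then show ?thesis by (auto simp: U_def cyl_def flip_def E_def)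
  qed
  \<comment> \<open>The flipped set may be neither finite nor cofinite, so membership in
    \<open>C\<close> cannot come from invariance; it comes from the cylinders inside the
    \<open>G i\<close>.\<close>
  have "U X \<in> G i" for X i
    using U_cyl[of X i] stage[of i] E_H[of X i] unfolding stage_def by blast
  then have U_C: "U X \<in> C" for X by (simp add: C_def)
  have \<Phi>_U: "\<Phi> (U X) \<in> cyl (\<Phi> (flip (E X i) u)) (N i)" for X i
    using U_cyl U_C stage[of i] E_H unfolding stage_def by blast
  have "power_set_copy (\<lambda>X. \<Phi> (U X)) (\<Phi> u) (\<lambda>i. \<Phi> (flip (F i) u)) N"
  proof
    show "strict_mono N" using N by (simp add: strict_mono_Suc_iff)
    show "\<Phi> (U X) \<in> cyl (\<Phi> (U Y)) (N i)" if "\<And>j. j < i \<Longrightarrow> X j = Y j" for X Y i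
    proof -
      have "E X i = E Y i" using that by (auto simp: E_def)
      then show ?thesis using \<Phi>_U[of X i] \<Phi>_U[of Y i] cyl_eq by metis
    qed
    show "weight (diff (if X i then \<Phi> (flip (F i) u) else \<Phi> u) (\<Phi> (U X)) \<inter> {N i..<N (Suc i)}) \<le> 1 / 2 ^ i" for X i
    proof -
      \<comment> \<open>\<open>w\<close> agrees with \<open>u\<close> below \<open>m i\<close>, so
        the further flip of \<open>E X i\<close> costs at most \<open>1 / 2 ^ i\<close> beyond
        \<open>N i\<close>. As \<open>F i\<close> is disjoint from \<open>E X i\<close>, the result
        is \<open>flip (E X (Suc i)) u\<close>, whose image agrees with \<open>\<Phi> (U X)\<close>
        below \<open>N (Suc i)\<close>.\<close>
      define w where "w = (if X i then flip (F i) u else u)"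
      have "w \<in> C" using u F(1)[of i] flip_C_finite by (simp add: w_def)
      moreover have "w \<in> cyl u (m i)" using F(2)[of i] by (auto simp: w_def cyl_def flip_def)
      ultimately have "w \<in> tail_close (E X i) i (N i)"
        using stage[of i] E_H unfolding stage_def by blast
      moreover have "flip (E X i) w = flip (E X (Suc i)) u"
        using F(2)[of i] E_less[of _ X i] by (force simp: w_def E_Suc flip_def fun_eq_iff)
      ultimately have "weight (diff (\<Phi> w) (\<Phi> (flip (E X (Suc i)) u)) \<inter> {N i..<N (Suc i)}) \<le> 1 / 2 ^ i"
        by (simp add: tail_close_def)
      moreover have "diff (\<Phi> w) (\<Phi> (U X)) \<inter> {N i..<N (Suc i)} =
          diff (\<Phi> w) (\<Phi> (flip (E X (Suc i)) u)) \<inter> {N i..<N (Suc i)}"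
        by (rule diff_Int_cong[OF mem_cyl_self \<Phi>_U])
      ultimately show ?thesis by (simp add: w_def if_distrib)
    qed
  qed (rule far)
  then show ?thesis by blast
qed

end

lemma reduction_fusion:
  fixes \<Phi> :: "cantor \<Rightarrow> cantor"
  assumes "delta11_fun \<Phi>" "\<And>a b. E2 a b \<longleftrightarrow> E2 (\<Phi> a) (\<Phi> b)"
  shows "\<exists>\<psi> a b N. power_set_copy \<psi> a b N \<and> range \<psi> \<subseteq> range \<Phi>"
proof -
  obtain M where M: "meager M" "\<forall>v n. v \<notin> M \<longrightarrow> (\<exists>m. \<forall>w\<in>cyl v m - M. \<Phi> w \<in> cyl (\<Phi> v) n)"
    using delta11_fun_continuous_comeager[OF assms(1)] by blast
  obtain G :: "nat \<Rightarrow> cantor set" where G: "\<forall>n. open (G n)" "meager (- (\<Inter>n. G n))"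
    "(\<Inter>n. G n) \<inter> M = {}" "\<forall>F\<in>fincofin. \<forall>v\<in>(\<Inter>n. G n). flip F v \<in> (\<Inter>n. G n)"
    using comeager_invariant_Gdelta[OF M(1)] by blast
  interpret generic_reduction \<Phi> G "\<Inter>n. G n"
  proof
    show "\<exists>m. \<forall>w\<in>(\<Inter>n. G n) \<inter> cyl v m. \<Phi> w \<in> cyl (\<Phi> v) n" if v: "v \<in> (\<Inter>n. G n)" for v n
    proof -
      have "v \<notin> M" using v G(3) by blast
      then obtain m where "\<forall>w\<in>cyl v m - M. \<Phi> w \<in> cyl (\<Phi> v) n" using M(2) by blast
      then show ?thesis using G(3) by blast
    qed
    show "flip F v \<in> (\<Inter>n. G n)" if "F \<in> fincofin" "v \<in> (\<Inter>n. G n)" for F v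
      using G(4) that by blast
  qed (use assms(2) G(1,2) in simp_all)
  show ?thesis by (rule fusion)
qed

section \<open>Discontinuity\<close>

lemma block_unique:
  assumes "strict_mono (N :: nat \<Rightarrow> nat)" "k \<in> {N i..<N (Suc i)}" "k \<in> {N j..<N (Suc j)}"
  shows "i = j"
proof -
  have "N i < N (Suc j)" "N j < N (Suc i)" using assms(2,3) by auto
  then have "i < Suc j" "j < Suc i" using strict_mono_less[OF assms(1)] by blast+
  then show ?thesis by simp
qed

lemma in_some_block:
  assumes "strict_mono (N :: nat \<Rightarrow> nat)" "N j \<le> k"
  obtains i where "j \<le> i" "k \<in> {N i..<N (Suc i)}"
proof -
  have "k \<le> N k" using assms(1) by (rule strict_mono_imp_increasing)
  then have ex: "k < N (Suc k)" using strict_monoD[OF assms(1), of k "Suc k"] by simp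
  define i where "i = (LEAST i. k < N (Suc i))"
  have i: "k < N (Suc i)" unfolding i_def using ex by (rule LeastI)
  have "N i \<le> k"
  proof (cases i)
    case 0
    then show ?thesis using assms strict_mono_less_eq[OF assms(1), of 0 j] by simp
  next
    case (Suc i')
    then show ?thesis using not_less_Least[of i' "\<lambda>i. k < N (Suc i)"] by (simp add: i_def[symmetric])
  qed
  moreover have "j \<le> i" using i assms(2) strict_mono_less[OF assms(1), of j "Suc i"] by simp
  ultimately show ?thesis using i that by simp
qed

lemma small_if_small_blocks:
  assumes "strict_mono (N :: nat \<Rightarrow> nat)" "\<And>i. weight (Z \<inter> {N i..<N (Suc i)}) \<le> 1 / 2 ^ i"
  shows "small Z"
proof -
  \<comment> \<open>\<open>2 - 2 / 2 ^ i\<close> is the sum of \<open>1 / 2 ^ j\<close> over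
    \<open>j < i\<close>; the part below \<open>N 0\<close> belongs to no block and is bounded
    separately.\<close>
  have bound: "weight (Z \<inter> {..<N i}) \<le> weight {..<N 0} + 2 - 2 / 2 ^ i" for i
  proof (induction i)
    case 0
    then show ?case by (auto intro: weight_mono)
  next
    case (Suc i)
    have "N i \<le> N (Suc i)" using assms(1) by (simp add: strict_mono_less_eq)
    then have "Z \<inter> {..<N (Suc i)} = (Z \<inter> {..<N i}) \<union> (Z \<inter> {N i..<N (Suc i)})" by auto
    then have "weight (Z \<inter> {..<N (Suc i)}) \<le> weight (Z \<inter> {..<N i}) + weight (Z \<inter> {N i..<N (Suc i)})"
      using weight_Un_le[of "Z \<inter> {..<N i}" "Z \<inter> {N i..<N (Suc i)}"] by simp
    then show ?case using Suc assms(2)[of i] by simp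
  qed
  obtain M :: nat where M: "weight {..<N 0} + 2 \<le> real M" using real_arch_simple by blast
  have "weight (Z \<inter> {..<n}) \<le> real M" for n
  proof -
    have "weight (Z \<inter> {..<n}) \<le> weight (Z \<inter> {..<N n})"
      using strict_mono_imp_increasing[OF assms(1), of n] by (intro weight_mono) auto
    also have "\<dots> \<le> real M"
      using bound[of n] M by (smt (verit) zero_le_divide_iff zero_le_power)
    finally show ?thesis .
  qed
  then show ?thesis by (auto simp: small_def)
qed

text \<open>The tails of a small set have weight tending to 0, which excludes weight 1 on blocks
  arbitrarily far out.\<close>

lemma not_small_if_large_blocks:
  assumes "strict_mono (N :: nat \<Rightarrow> nat)" "infinite Q"
    "\<And>i. i \<in> Q \<Longrightarrow> 1 \<le> weight (Z \<inter> {N i..<N (Suc i)})"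
  shows "\<not> small Z"
proof
  assume "small Z"
  then obtain n0 where n0: "\<And>n. weight (Z \<inter> {n0..<n}) \<le> 1 / 2"
    using small_tail[of Z "1 / 2"] by auto
  obtain i where i: "i \<in> Q" "n0 \<le> i" using assms(2) by (meson infinite_nat_iff_unbounded_le)
  then have "n0 \<le> N i" using strict_mono_imp_increasing[OF assms(1), of i] by simp
  then have "weight (Z \<inter> {N i..<N (Suc i)}) \<le> weight (Z \<inter> {n0..<N (Suc i)})"
    by (intro weight_mono) auto
  then show False using n0[of "N (Suc i)"] assms(3)[OF i(1)] by simp
qed

lemma small_Un_iff: "small (A \<union> B) \<longleftrightarrow> small A \<and> small B"
  using small_Un small_subset by blast

text \<open>Meant for conditions on \<open>i\<close> that have period 2 from \<open>j\<close> on: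
  one hit in each pair suffices.\<close>

lemma infinite_if_frequently:
  assumes "\<And>n. n < j \<or> P (2 * n) \<or> P (2 * n + 1)"
  shows "infinite {i :: nat. P i}"
  unfolding infinite_nat_iff_unbounded_le
proof
  fix m
  have "P (2 * (m + j)) \<or> P (2 * (m + j) + 1)" using assms[of "m + j"] by simp
  then show "\<exists>n\<ge>m. n \<in> {i. P i}"
  proof
    assume "P (2 * (m + j))"
    then show ?thesis by (intro exI[of _ "2 * (m + j)"]) simp
  next
    assume "P (2 * (m + j) + 1)"
    then show ?thesis by (intro exI[of _ "2 * (m + j) + 1"]) simp
  qed
qed

section \<open>Betweenness on a copy of the power set\<close>

context power_set_copy
begin

definition err :: "(nat \<Rightarrow> bool) \<Rightarrow> nat set" where
  "err X = {k. \<exists>i. k \<in> {N i..<N (Suc i)} \<and> k \<in> diff (if X i then b i else a) (\<psi> X)}"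

lemma small_err: "small (err X)"
proof (rule small_if_small_blocks[OF N])
  fix i
  have "err X \<inter> {N i..<N (Suc i)} \<subseteq> diff (if X i then b i else a) (\<psi> X) \<inter> {N i..<N (Suc i)}"
  proof
    fix k assume "k \<in> err X \<inter> {N i..<N (Suc i)}"
    then obtain j where "k \<in> {N j..<N (Suc j)}" "k \<in> diff (if X j then b j else a) (\<psi> X)"
      "k \<in> {N i..<N (Suc i)}" by (auto simp: err_def)
    then show "k \<in> diff (if X i then b i else a) (\<psi> X) \<inter> {N i..<N (Suc i)}"
      using block_unique[OF N, of k j i] by blast
  qed
  then have "weight (err X \<inter> {N i..<N (Suc i)}) \<le> weight (diff (if X i then b i else a) (\<psi> X) \<inter> {N i..<N (Suc i)})"
    by (intro weight_mono) simp_all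
  then show "weight (err X \<inter> {N i..<N (Suc i)}) \<le> 1 / 2 ^ i" using close[of X i] by (rule order_trans)
qed

lemma copy_eq: "k \<in> {N i..<N (Suc i)} \<Longrightarrow> k \<notin> err X \<Longrightarrow> \<psi> X k = (if X i then b i k else a k)"
  by (auto simp: err_def diff_def)

definition block_diff :: "nat set \<Rightarrow> nat set" where
  "block_diff Q = {k. \<exists>i\<in>Q. k \<in> {N i..<N (Suc i)} \<and> k \<in> diff a (b i)}"

lemma not_small_block_diff:
  assumes "infinite Q"
  shows "\<not> small (block_diff Q)"
proof (rule not_small_if_large_blocks[OF N assms])
  fix i assume "i \<in> Q"
  then have "diff a (b i) \<inter> {N i..<N (Suc i)} \<subseteq> block_diff Q \<inter> {N i..<N (Suc i)}"
    by (auto simp: block_diff_def)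
  then have "weight (diff a (b i) \<inter> {N i..<N (Suc i)}) \<le> weight (block_diff Q \<inter> {N i..<N (Suc i)})"
    by (intro weight_mono) simp_all
  then show "1 \<le> weight (block_diff Q \<inter> {N i..<N (Suc i)})" using far by (rule order_trans[rotated])
qed

text \<open>On a block where \<open>X\<close> and \<open>Y\<close> differ, up to errors one image
  follows \<open>a\<close> and the other \<open>b i\<close>; infinitely many such blocks have
  infinite total weight.\<close>

lemma not_E2_copy:
  assumes "infinite {i. X i \<noteq> Y i}"
  shows "\<not> E2 (\<psi> X) (\<psi> Y)"
proof
  assume "E2 (\<psi> X) (\<psi> Y)"
  then have "small ({k. \<psi> X k \<noteq> \<psi> Y k} \<union> err X \<union> err Y)"
    by (simp add: small_Un_iff small_err E2_iff_small)
  moreover have "block_diff {i. X i \<noteq> Y i} \<subseteq> {k. \<psi> X k \<noteq> \<psi> Y k} \<union> err X \<union> err Y"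
  proof
    fix k assume "k \<in> block_diff {i. X i \<noteq> Y i}"
    then obtain i where i: "X i \<noteq> Y i" "k \<in> {N i..<N (Suc i)}" "a k \<noteq> b i k"
      by (auto simp: block_diff_def diff_def)
    then show "k \<in> {k. \<psi> X k \<noteq> \<psi> Y k} \<union> err X \<union> err Y"
      using copy_eq[OF i(2), of X] copy_eq[OF i(2), of Y] by (auto split: if_splits)
  qed
  ultimately show False using not_small_block_diff[OF assms] small_subset by blast
qed

text \<open>Up to errors the two ends are \<open>a\<close> and \<open>b i\<close>. Where these
  agree, they leave only one value for the third point.\<close>

lemma off_segment_small:
  assumes "\<And>i. \<not> X i" "\<And>i. Y i"
  shows "small (off_segment (\<psi> X, \<psi> Y, \<psi> Z))"
proof (rule small_subset)
  show "small ({..<N 0} \<union> err X \<union> err Y \<union> err Z)"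
    by (simp add: small_Un_iff small_err small_finite)
  show "off_segment (\<psi> X, \<psi> Y, \<psi> Z) \<subseteq> {..<N 0} \<union> err X \<union> err Y \<union> err Z"
  proof
    fix k assume k: "k \<in> off_segment (\<psi> X, \<psi> Y, \<psi> Z)"
    show "k \<in> {..<N 0} \<union> err X \<union> err Y \<union> err Z"
    proof (rule ccontr)
      assume no: "\<not> ?thesis"
      then obtain i where i: "k \<in> {N i..<N (Suc i)}"
        using in_some_block[OF N, of 0 k] by (auto simp: not_less)
      have "\<psi> X k = a k" "\<psi> Y k = b i k" "\<psi> Z k = (if Z i then b i k else a k)"
        using copy_eq[OF i, of X] copy_eq[OF i, of Y] copy_eq[OF i, of Z] no assms by simp_all
      moreover have "\<psi> X k = \<psi> Y k" "\<psi> Z k \<noteq> \<psi> X k"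
        using k by (simp_all add: off_segment_def)
      ultimately show False by metis
    qed
  qed
qed

text \<open>On the blocks in question both ends follow \<open>a\<close> and the third point follows
  \<open>b i\<close>, so all of \<open>diff a (b i)\<close> there is off the segment, up to
  errors.\<close>

lemma off_segment_not_small:
  assumes "infinite {i. \<not> X i \<and> \<not> Y i \<and> Z i}"
  shows "\<not> small (off_segment (\<psi> X, \<psi> Y, \<psi> Z))"
proof
  assume "small (off_segment (\<psi> X, \<psi> Y, \<psi> Z))"
  then have "small (off_segment (\<psi> X, \<psi> Y, \<psi> Z) \<union> err X \<union> err Y \<union> err Z)"
    by (simp add: small_Un_iff small_err)
  moreover have "block_diff {i. \<not> X i \<and> \<not> Y i \<and> Z i} \<subseteq> off_segment (\<psi> X, \<psi> Y, \<psi> Z) \<union> err X \<union> err Y \<union> err Z"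
  proof
    fix k assume "k \<in> block_diff {i. \<not> X i \<and> \<not> Y i \<and> Z i}"
    then obtain i where i: "\<not> X i" "\<not> Y i" "Z i" "k \<in> {N i..<N (Suc i)}" "a k \<noteq> b i k"
      by (auto simp: block_diff_def diff_def)
    then show "k \<in> off_segment (\<psi> X, \<psi> Y, \<psi> Z) \<union> err X \<union> err Y \<union> err Z"
      using copy_eq[OF i(4), of X] copy_eq[OF i(4), of Y] copy_eq[OF i(4), of Z] by (auto simp: off_segment_def)
  qed
  ultimately show False using not_small_block_diff[OF assms] small_subset by blast
qed

lemma betweenness_not_continuous:
  assumes "range \<psi> \<subseteq> A"
  shows "\<not> continuous_on (inequiv_triples E2 A) betweenness"
proof
  assume cont: "continuous_on (inequiv_triples E2 A) betweenness"
  define X Y Z where "X = (\<lambda>i :: nat. False)" and "Y = (\<lambda>i :: nat. True)" and "Z = (\<lambda>i :: nat. even i)"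
  \<comment> \<open>The tails of \<open>Y\<close> and \<open>Z\<close> are exchanged from
    \<open>j\<close> on. The odd numbers from \<open>j\<close> on then lie in \<open>Z' j\<close>
    but not in \<open>X\<close> or \<open>Y' j\<close>, so betweenness fails for every
    \<open>j\<close>, although \<open>Y' j\<close> and \<open>Z' j\<close> converge to
    \<open>Y\<close> and \<open>Z\<close>.\<close>
  define Y' Z' where "Y' j = (\<lambda>i. if i < j then Y i else Z i)"
    and "Z' j = (\<lambda>i. if i < j then Z i else Y i)" for j
  note defs = X_def Y_def Z_def Y'_def Z'_def
  have triple: "(\<psi> P, \<psi> Q, \<psi> R) \<in> inequiv_triples E2 A"
    if "infinite {i. P i \<noteq> Q i}" "infinite {i. P i \<noteq> R i}" "infinite {i. Q i \<noteq> R i}" for P Q R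
  proof -
    have "infinite {i. Q i \<noteq> P i}" "infinite {i. R i \<noteq> P i}" "infinite {i. R i \<noteq> Q i}"
      using that by (simp_all add: eq_commute)
    then show ?thesis
      using that not_E2_copy assms by (auto simp: inequiv_triples_def)
  qed
  have p: "(\<psi> X, \<psi> Y, \<psi> Z) \<in> inequiv_triples E2 A"
    by (intro triple infinite_if_frequently[of 0]) (auto simp: defs)
  have p': "(\<psi> X, \<psi> (Y' j), \<psi> (Z' j)) \<in> inequiv_triples E2 A" for j
    by (intro triple infinite_if_frequently[of j]) (auto simp: defs)
  have "open {w :: cantor. w 0}"
    using open_vimage[of "{True}" "\<lambda>w :: cantor. w 0"] by (simp add: open_discrete vimage_def)
  then obtain U where U: "open U" "U \<inter> inequiv_triples E2 A = betweenness -` {w. w 0} \<inter> inequiv_triples E2 A"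
    using cont unfolding continuous_on_open_invariant by metis
  have "betweenness (\<psi> X, \<psi> Y, \<psi> Z) 0"
    using off_segment_small[of X Y Z] by (simp add: betweenness_def defs)
  then have "(\<psi> X, \<psi> Y, \<psi> Z) \<in> U" using U(2) p by blast
  then obtain A1 A2 A3 where A: "open A2" "open A3" "\<psi> X \<in> A1" "\<psi> Y \<in> A2" "\<psi> Z \<in> A3" "A1 \<times> (A2 \<times> A3) \<subseteq> U"
  proof -
    obtain A1 A23 where 1: "open A23" "\<psi> X \<in> A1" "(\<psi> Y, \<psi> Z) \<in> A23" "A1 \<times> A23 \<subseteq> U"
      using open_prod_elim[OF U(1) \<open>(\<psi> X, \<psi> Y, \<psi> Z) \<in> U\<close>] by (metis mem_Sigma_iff)
    obtain A2 A3 where "open A2" "open A3" "\<psi> Y \<in> A2" "\<psi> Z \<in> A3" "A2 \<times> A3 \<subseteq> A23"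
      using open_prod_elim[OF 1(1,3)] by (metis mem_Sigma_iff)
    moreover from this have "A1 \<times> (A2 \<times> A3) \<subseteq> U"
      using 1(4) by (meson Sigma_mono order_refl order_trans)
    ultimately show ?thesis using 1(2) by (intro that)
  qed
  obtain m where m: "cyl (\<psi> Y) m \<subseteq> A2" using open_contains_cyl[OF A(1,4)] .
  obtain m' where m': "cyl (\<psi> Z) m' \<subseteq> A3" using open_contains_cyl[OF A(2,5)] .
  \<comment> \<open>As \<open>N j\<close> is at least \<open>j\<close>, agreement of the arguments
    below \<open>j\<close> gives agreement of their images below both \<open>m\<close> and
    \<open>m'\<close>.\<close>
  define j where "j = max m m'"
  have "m \<le> N j" "m' \<le> N j"
    using strict_mono_imp_increasing[OF N, of j] by (auto simp: j_def)
  moreover have "\<psi> (Y' j) \<in> cyl (\<psi> Y) (N j)" "\<psi> (Z' j) \<in> cyl (\<psi> Z) (N j)"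
    by (auto intro!: local simp: defs)
  ultimately have "\<psi> (Y' j) \<in> A2" "\<psi> (Z' j) \<in> A3"
    using m m' cyl_mono by blast+
  then have "(\<psi> X, \<psi> (Y' j), \<psi> (Z' j)) \<in> U" using A(3,6) by blast
  then have "betweenness (\<psi> X, \<psi> (Y' j), \<psi> (Z' j)) 0" using U(2) p' by blast
  moreover have "\<not> small (off_segment (\<psi> X, \<psi> (Y' j), \<psi> (Z' j)))"
    by (intro off_segment_not_small infinite_if_frequently[of j]) (auto simp: defs)
  ultimately show False by (simp add: betweenness_def)
qed

end

theorem theorem16p7:
  "\<exists>K :: cantor \<times> cantor \<times> cantor \<Rightarrow> cantor. delta11_fun K \<and>
     (\<forall>A :: cantor set. sigma11 A \<longrightarrow> delta11_reducible_to_restriction E2 E2 A \<longrightarrow>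
        \<not> continuous_on (inequiv_triples E2 A) K)"
proof (intro exI conjI allI impI)
  show "delta11_fun betweenness" by (rule delta11_fun_betweenness)
  fix A :: "cantor set"
  assume "delta11_reducible_to_restriction E2 E2 A"
  then obtain \<Phi> where \<Phi>: "delta11_fun \<Phi>" "range \<Phi> \<subseteq> A" "\<And>a b. E2 a b \<longleftrightarrow> E2 (\<Phi> a) (\<Phi> b)"
    unfolding delta11_reducible_to_restriction_def by blast
  obtain \<psi> a b N where copy: "power_set_copy \<psi> a b N" and "range \<psi> \<subseteq> range \<Phi>"
    using reduction_fusion[OF \<Phi>(1,3)] by (elim exE conjE) (rule that)
  then have "range \<psi> \<subseteq> A" using \<Phi>(2) by blast
  then show "\<not> continuous_on (inequiv_triples E2 A) betweenness"
    by (rule power_set_copy.betweenness_not_continuous[OF copy])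
qed

end
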